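(* Let $n\ge2$. Suppose that for every $p\in\mathbb{N}$, every $K\in\mathcal{K}(\mathbb{R}^n)$ with $\dim(K)=n$ and every $t\in[0,1]$ one has $$\frac{|D_p^tK|}{|K|^p}\leq\frac{|D_p^tS_n|}{|S_n|^p},$$ where $S_n\in\mathcal{K}(\mathbb{R}^n)$ is an $n$-simplex, and that if equality holds for some $t\in(0,1)$, then $K$ is a simplex. Then for every $p\in\mathbb{N}$, $K\in\mathcal{K}(\mathbb{R}^n)$ and $t\in[0,1]$ one has $$\sum_{j=0}^n c_{n,p,j}(t)\,V\big(-\Delta_pK[j],K^p[np-j]\big)\leq|K|^p,\qquad c_{n,p,j}(t)=\sum_{m=0}^{np-j}\binom{np-m}{j}\frac{(np)!\,n!}{m!\,(np+n-m)!}(1-t)^mt^{np-m},$$ and if $\dim(K)=n$ and equality holds in the latter inequality for some $t\in(0,1)$, then $K$ is a simplex.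
   Context: $\mathcal{K}(\mathbb{R}^n)$ denotes the set of convex bodies, i.e. nonempty compact convex subsets of $\mathbb{R}^n$; $|\cdot|$ is Lebesgue measure (in the dimension of the ambient space); $\dim K$ is the dimension of the affine span of $K$; a simplex is the convex hull of affinely independent points, an $n$-simplex that of $n+1$ such points. The mixed volume of $K_1,\dots,K_N\in\mathcal{K}(\mathbb{R}^N)$ is $V(K_1,\dots,K_N)=\frac1{N!}\frac{\partial^N}{\partial t_1\cdots\partial t_N}\big|_{t_1=\dots=t_N=0}|t_1K_1+\dots+t_NK_N|$ (Minkowski sums; the volume is a homogeneous polynomial of degree $N$ in $t_1,\dots,t_N\ge0$). $L[k]$ means that $L$ is repeated $k$ times. Identify $\mathbb{R}^{np}=(\mathbb{R}^n)^p$; $\Delta_p:\mathbb{R}^n\to\mathbb{R}^{np}$, $\Delta_p(x)=(x,\dots,x)$; $K^p=K\times\cdots\times K\subset\mathbb{R}^{np}$. The higher-order unbalanced difference body is $D_p^tK=(1-t)K^p-t\Delta_pK=\{(1-t)y-t\Delta_p(x):x\in K,\ y\in K^p\}\subset\mathbb{R}^{np}$. Convention $0^0=1$. (The ratio $|D_p^tS_n|/|S_n|^p$ does not depend on the choice of the $n$-simplex, by affine invariance.) *)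

theory Defs
  imports "HOL-Analysis.Analysis"
begin

text \<open>
  The number \<open>p\<close> of copies varies inside the statement, so points of the \<open>p\<close>-fold power of
  \<open>\<real>\<^sup>n\<close> are represented by functions \<open>nat \<Rightarrow> real ^ 'n\<close> that are extensional on \<open>{..<p}\<close>
  (elements of \<open>{..<p} \<rightarrow>\<^sub>E UNIV\<close>).  All constructions below therefore end in a restriction to \<open>{..<p}\<close>.
\<close>

definition convex_body :: "(real ^ 'n) set \<Rightarrow> bool" where
  "convex_body K \<longleftrightarrow> K \<noteq> {} \<and> compact K \<and> convex K"

text \<open>
  Lebesgue measure of dimension \<open>CARD('n) * p\<close>.  It is only applied to compact sets, so completing
  the product measure would make no difference.
\<close>

definition vol_power :: "nat \<Rightarrow> (nat \<Rightarrow> real ^ 'n) set \<Rightarrow> real" where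
  "vol_power p A = measure (\<Pi>\<^sub>M i\<in>{..<p}. lborel) A"

definition body_power :: "nat \<Rightarrow> (real ^ 'n) set \<Rightarrow> (nat \<Rightarrow> real ^ 'n) set" where
  "body_power p K = (\<Pi>\<^sub>E i\<in>{..<p}. K)"

definition diag :: "nat \<Rightarrow> real ^ 'n \<Rightarrow> (nat \<Rightarrow> real ^ 'n)" where
  "diag p x = (\<lambda>i\<in>{..<p}. x)"

definition neg_power :: "nat \<Rightarrow> (nat \<Rightarrow> real ^ 'n) set \<Rightarrow> (nat \<Rightarrow> real ^ 'n) set" where
  "neg_power p A = (\<lambda>z. \<lambda>i\<in>{..<p}. - z i) ` A"

definition unbalanced_difference_body ::
    "nat \<Rightarrow> real \<Rightarrow> (real ^ 'n) set \<Rightarrow> (nat \<Rightarrow> real ^ 'n) set" where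
  "unbalanced_difference_body p t K =
     {\<lambda>i\<in>{..<p}. (1 - t) *\<^sub>R y i - t *\<^sub>R diag p x i | x y. x \<in> K \<and> y \<in> body_power p K}"

text \<open>The Minkowski combination \<open>s\<^sub>0 L\<^sub>0 + \<dots> + s\<^sub>N\<^sub>-\<^sub>1 L\<^sub>N\<^sub>-\<^sub>1\<close>; indices start at \<open>0\<close>.\<close>

definition minkowski_comb ::
    "nat \<Rightarrow> nat \<Rightarrow> (nat \<Rightarrow> real) \<Rightarrow> (nat \<Rightarrow> (nat \<Rightarrow> real ^ 'n) set) \<Rightarrow> (nat \<Rightarrow> real ^ 'n) set" where
  "minkowski_comb p N s L =
     {\<lambda>i\<in>{..<p}. \<Sum>k<N. s k *\<^sub>R x k i | x. \<forall>k<N. x k \<in> L k}"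

text \<open>
  The volume of a Minkowski combination is a polynomial in the coefficients only where these are
  nonnegative.  Hence partial derivatives are taken within the half-line \<open>{0..}\<close>, which makes them
  one-sided at \<open>0\<close>.
\<close>

definition partial_nonneg ::
    "nat \<Rightarrow> ((nat \<Rightarrow> real) \<Rightarrow> real) \<Rightarrow> (nat \<Rightarrow> real) \<Rightarrow> real" where
  "partial_nonneg k F s = vector_derivative (\<lambda>u. F (s(k := u))) (at (s k) within {0..})"

text \<open>
  Mixed volume of \<open>L\<^sub>0, \<dots>, L\<^sub>N\<^sub>-\<^sub>1\<close> with \<open>N = CARD('n) * p\<close>; the fold is the iterated derivative
  \<open>\<partial>\<^sub>0 \<partial>\<^sub>1 \<dots> \<partial>\<^sub>N\<^sub>-\<^sub>1\<close>, evaluated at the origin.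
\<close>

definition mixed_volume :: "nat \<Rightarrow> (nat \<Rightarrow> (nat \<Rightarrow> real ^ 'n) set) \<Rightarrow> real" where
  "mixed_volume p L =
     (let N = CARD('n) * p in
      foldr partial_nonneg [0..<N] (\<lambda>s. vol_power p (minkowski_comb p N s L)) (\<lambda>_. 0) / fact N)"

definition mixed_coeff :: "nat \<Rightarrow> nat \<Rightarrow> nat \<Rightarrow> real \<Rightarrow> real" where
  "mixed_coeff n p j t =
     (\<Sum>m = 0..n * p - j. real ((n * p - m) choose j)
        * (fact (n * p) * fact n / (fact m * fact (n * p + n - m)))
        * (1 - t) ^ m * t ^ (n * p - m))"

end

theory Submission
  imports Defs "HOL-Computational_Algebra.Polynomial"
begin

text \<open>
  Write \<open>f\<^sub>K(a, b)\<close> for the volume of \<open>a K\<^sup>p - b \<Delta>\<^sub>p K\<close> and \<open>N = n p\<close>.  Modulo the diagonal translations the fibres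
  of this body are Minkowski sums \<open>Q + b (-K)\<close> in \<open>\<real>\<^sup>n\<close>, so \<open>f\<^sub>K\<close> is a polynomial \<open>\<Sum>\<^sub>i\<^sub>\<le>\<^sub>n \<alpha>\<^sub>i a\<^bsup>N-i\<^esup> b\<^sup>i\<close>, the mixed
  volumes are \<open>\<alpha>\<^sub>j\<close> divided by \<open>N\<close> choose \<open>j\<close>, and a beta integral turns the sum over \<open>j\<close> into
  \<open>\<integral>\<^sub>0\<^sup>1 n (1 - u)\<^bsup>n-1\<^esup> f\<^sub>K(1 - t + t u, t u) du\<close>.  This integral is at most \<open>|K|\<^sup>p\<close> for every convex body: if \<open>z\<close> lies in
  \<open>(1 - t + t u) K\<^sup>p - t u \<Delta>\<^sub>p K\<close>, then \<open>t K \<inter> (K - z\<^sub>1) \<inter> \<dots> \<inter> (K - z\<^sub>p)\<close> contains a translate of \<open>t (1 - u) K\<close>, and the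
  volumes of these intersections integrate to \<open>t\<^sup>n |K|\<^bsup>p+1\<^esup>\<close>.  The hypotheses only enter the equality case:
  equality for \<open>K\<close> forces equality in the comparison with \<open>S\<close> under the integral sign.
\<close>

section \<open>Interpolation of polynomials\<close>

text \<open>The degree in \<open>b\<close> is at most \<open>n\<close> instead of \<open>N\<close>
  because \<open>b\<close> only scales the diagonal body: with the last coordinate as reference,
  \<open>Q\<close> is an intersection of translates of \<open>a K\<close> that does not involve
  \<open>b\<close>. Everything then rests on one fact in R^n: the volume of \<open>A + b B\<close>
  is a polynomial of degree at most \<open>n\<close> in \<open>b\<close>. For polytopes this is read
  off from a change of variables. Smoothing the support functions of the vertex sets by log-sum-exp
  gives gradient maps whose sum fills the Minkowski sum up to a null set, and the Jacobian
  determinant is a polynomial in \<open>b\<close> at every point. Polynomiality must then survive an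
  integral over points, a limit over polytopes and an integral over fibres, so it is expressed by an
  identity between values. Only positive \<open>b\<close> are covered in this way; the edges
  \<open>a = 0\<close> and \<open>b = 0\<close>, which the one-sided derivatives behind mixed
  volumes require, are reached by sandwich bounds.\<close>

definition lagrange_basis :: "nat \<Rightarrow> nat \<Rightarrow> real poly" where
  "lagrange_basis n k =
     (\<Prod>j\<in>{..n} - {k}. smult (1 / (real k - real j)) [:- (real j + 1), 1:])"

text \<open>Being a polynomial of degree at most \<open>n\<close> on the positive half-line, as a
  linear identity between finitely many values. This form passes to pointwise limits and to
  parameter integrals without any control of coefficients. The nodes are
  \<open>1, ..., n + 1\<close>, so that only positive arguments occur.\<close>

definition interpolated :: "nat \<Rightarrow> (real \<Rightarrow> real) \<Rightarrow> bool" where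
  "interpolated n h \<longleftrightarrow> (\<forall>b>0. h b = (\<Sum>k\<le>n. h (real k + 1) * poly (lagrange_basis n k) b))"

lemma degree_lagrange_basis:
  assumes "k \<le> n"
  shows "degree (lagrange_basis n k) \<le> n"
proof -
  have "degree (lagrange_basis n k) \<le>
      (\<Sum>j\<in>{..n} - {k}. degree (smult (1 / (real k - real j)) [:- (real j + 1), 1:]))"
    unfolding lagrange_basis_def by (rule order_trans[OF degree_prod_sum_le]) (auto simp: o_def)
  also have "\<dots> \<le> (\<Sum>j\<in>{..n} - {k}. 1)"
    by (intro sum_mono) (auto intro: order_trans[OF degree_smult_le])
  also have "\<dots> = n" using assms by simp
  finally show ?thesis .
qed

lemma lagrange_basis_node:
  assumes "k \<le> n" "i \<le> n"
  shows "poly (lagrange_basis n k) (real i + 1) = (if i = k then 1 else 0)"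
proof (cases "i = k")
  case True
  then show ?thesis
    by (auto simp: lagrange_basis_def poly_prod divide_simps intro!: prod.neutral)
next
  case False
  then have "\<exists>j\<in>{..n} - {k}. poly (smult (1 / (real k - real j)) [:- (real j + 1), 1:]) (real i + 1) = 0"
    using assms by (intro bexI[of _ i]) (auto simp: field_simps)
  then show ?thesis
    using False by (simp add: lagrange_basis_def poly_prod prod_zero_iff del: smult_pCons)
qed

lemma interpolated_poly:
  assumes "degree p \<le> n" "\<And>b. b > 0 \<Longrightarrow> h b = poly p b"
  shows "interpolated n h"
proof -
  define q where "q = (\<Sum>k\<le>n. smult (poly p (real k + 1)) (lagrange_basis n k))"
  have "p = q"
  proof (rule poly_eqI_degree[of "(\<lambda>k. real k + 1) ` {..n}"])
    have c: "card ((\<lambda>k. real k + 1) ` {..n}) = Suc n"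
      by (subst card_image) (auto simp: inj_on_def)
    then show "degree p < card ((\<lambda>k. real k + 1) ` {..n})" using assms by simp
    have "degree q \<le> n"
      unfolding q_def using degree_lagrange_basis
      by (intro degree_sum_le) (auto intro: order_trans[OF degree_smult_le])
    then show "degree q < card ((\<lambda>k. real k + 1) ` {..n})" using c by simp
  next
    fix x assume "x \<in> (\<lambda>k. real k + 1) ` {..n}"
    then obtain i where i: "i \<le> n" "x = real i + 1" by auto
    have "poly q x = (\<Sum>k\<le>n. if i = k then poly p (real k + 1) else 0)"
      unfolding q_def i poly_sum poly_smult
      by (intro sum.cong refl) (use i lagrange_basis_node in auto)
    then show "poly p x = poly q x" using i by simp
  qed
  have "h b = (\<Sum>k\<le>n. h (real k + 1) * poly (lagrange_basis n k) b)" if "b > 0" for b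
  proof -
    have "h b = poly q b" using \<open>p = q\<close> assms(2)[OF that] by metis
    also have "\<dots> = (\<Sum>k\<le>n. poly p (real k + 1) * poly (lagrange_basis n k) b)"
      by (simp add: q_def poly_sum)
    also have "\<dots> = (\<Sum>k\<le>n. h (real k + 1) * poly (lagrange_basis n k) b)"
      by (intro sum.cong) (auto simp: assms(2))
    finally show ?thesis .
  qed
  then show ?thesis unfolding interpolated_def by blast
qed

lemma interpolated_imp_poly:
  assumes "interpolated n h"
  obtains p where "degree p \<le> n" "\<And>b. b > 0 \<Longrightarrow> h b = poly p b"
proof
  show "degree (\<Sum>k\<le>n. smult (h (real k + 1)) (lagrange_basis n k)) \<le> n"
    using degree_lagrange_basis by (intro degree_sum_le) (auto intro: order_trans[OF degree_smult_le])
  show "h b = poly (\<Sum>k\<le>n. smult (h (real k + 1)) (lagrange_basis n k)) b" if "b > 0" for b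
    using assms that by (simp add: interpolated_def poly_sum)
qed

lemma interpolated_LIMSEQ:
  assumes "\<And>i. interpolated n (h i)" "\<And>b. b > 0 \<Longrightarrow> (\<lambda>i. h i b) \<longlonglongrightarrow> g b"
  shows "interpolated n g"
  unfolding interpolated_def
proof (intro allI impI)
  fix b :: real assume b: "b > 0"
  have "(\<lambda>i. \<Sum>k\<le>n. h i (real k + 1) * poly (lagrange_basis n k) b)
      \<longlonglongrightarrow> (\<Sum>k\<le>n. g (real k + 1) * poly (lagrange_basis n k) b)"
    by (intro tendsto_intros assms(2)) auto
  moreover have "(\<lambda>i. \<Sum>k\<le>n. h i (real k + 1) * poly (lagrange_basis n k) b) = (\<lambda>i. h i b)"
    using assms(1) b by (auto simp: interpolated_def)
  ultimately show "g b = (\<Sum>k\<le>n. g (real k + 1) * poly (lagrange_basis n k) b)"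
    using LIMSEQ_unique assms(2)[OF b] by metis
qed

lemma interpolated_integral:
  fixes e :: "real \<Rightarrow> 'a::euclidean_space \<Rightarrow> real"
  assumes "\<And>x. interpolated n (\<lambda>b. e b x)" "\<And>b. b > 0 \<Longrightarrow> (e b has_integral h b) UNIV"
  shows "interpolated n h"
  unfolding interpolated_def
proof (intro allI impI)
  fix b :: real assume b: "b > 0"
  have "((\<lambda>x. \<Sum>k\<le>n. e (real k + 1) x * poly (lagrange_basis n k) b)
      has_integral (\<Sum>k\<le>n. h (real k + 1) * poly (lagrange_basis n k) b)) UNIV"
    by (intro has_integral_sum has_integral_mult_left assms(2)) auto
  moreover have "(\<lambda>x. \<Sum>k\<le>n. e (real k + 1) x * poly (lagrange_basis n k) b) = e b"
    using assms(1) b by (auto simp: interpolated_def)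
  ultimately show "h b = (\<Sum>k\<le>n. h (real k + 1) * poly (lagrange_basis n k) b)"
    using assms(2)[OF b] has_integral_unique by metis
qed

text \<open>In the Leibniz expansion each permutation contributes a product of
  \<open>CARD('n)\<close> factors that are affine in \<open>b\<close>.\<close>

lemma interpolated_det_pencil:
  fixes A B :: "real^'n^'n"
  shows "interpolated CARD('n) (\<lambda>b. det (A + b *\<^sub>R B))"
proof -
  define q where "q = (\<Sum>\<pi> | \<pi> permutes (UNIV::'n set).
      smult (of_int (sign \<pi>)) (\<Prod>i\<in>UNIV. [:A $ i $ \<pi> i, B $ i $ \<pi> i:]))"
  have "degree (\<Prod>i\<in>UNIV. [:A $ i $ \<pi> i, B $ i $ \<pi> i:]) \<le> CARD('n)" for \<pi>
  proof -
    have "degree (\<Prod>i\<in>UNIV. [:A $ i $ \<pi> i, B $ i $ \<pi> i:])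
        \<le> (\<Sum>i\<in>(UNIV::'n set). degree [:A $ i $ \<pi> i, B $ i $ \<pi> i:])"
      using degree_prod_sum_le[of UNIV "\<lambda>i. [:A $ i $ \<pi> i, B $ i $ \<pi> i:]"]
      by (simp only: o_def finite)
    also have "\<dots> \<le> (\<Sum>i\<in>(UNIV::'n set). 1)" by (intro sum_mono) auto
    finally show ?thesis by simp
  qed
  then have "degree q \<le> CARD('n)"
    unfolding q_def
    by (intro degree_sum_le order_trans[OF degree_smult_le] finite_permutations finite) blast
  moreover have "det (A + b *\<^sub>R B) = poly q b" for b
    by (simp add: det_def q_def poly_sum poly_prod)
  ultimately show ?thesis by (intro interpolated_poly) auto
qed

section \<open>Volume of Minkowski sums\<close>

text \<open>\<open>ln (partition_fun V)\<close> is a smooth upper bound for the support function of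
  the convex hull of \<open>V\<close>. Its gradient is the mean of \<open>V\<close> under the Gibbs
  weights proportional to \<open>exp (x \<bullet> v)\<close>, its Hessian their covariance; these
  are the next two definitions.\<close>

definition partition_fun :: "'a::euclidean_space set \<Rightarrow> 'a \<Rightarrow> real" where
  "partition_fun V x = (\<Sum>v\<in>V. exp (x \<bullet> v))"

definition gibbs_mean :: "'a::euclidean_space set \<Rightarrow> 'a \<Rightarrow> 'a" where
  "gibbs_mean V x = (\<Sum>v\<in>V. exp (x \<bullet> v) *\<^sub>R v) /\<^sub>R partition_fun V x"

definition gibbs_cov :: "'a::euclidean_space set \<Rightarrow> 'a \<Rightarrow> 'a \<Rightarrow> 'a" where
  "gibbs_cov V x h =
     (\<Sum>v\<in>V. (exp (x \<bullet> v) / partition_fun V x * (h \<bullet> v)) *\<^sub>R v)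
     - (\<Sum>v\<in>V. exp (x \<bullet> v) / partition_fun V x * (h \<bullet> v)) *\<^sub>R gibbs_mean V x"

lemma partition_fun_pos:
  assumes "finite V" "V \<noteq> {}"
  shows "partition_fun V x > 0"
  unfolding partition_fun_def using assms by (intro sum_pos) auto

lemma has_derivative_partition_fun:
  "(partition_fun V has_derivative (\<lambda>h. \<Sum>v\<in>V. exp (x \<bullet> v) * (h \<bullet> v))) (at x within S)"
  unfolding partition_fun_def [abs_def]
  by (auto intro!: derivative_eq_intros simp: mult.commute)

lemma has_derivative_ln_partition_fun:
  assumes "finite V" "V \<noteq> {}"
  shows "((\<lambda>x. ln (partition_fun V x)) has_derivative (\<lambda>h. h \<bullet> gibbs_mean V x)) (at x within S)"
proof -
  have "((\<lambda>x. ln (partition_fun V x)) has_derivative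
      (\<lambda>h. (\<Sum>v\<in>V. exp (x \<bullet> v) * (h \<bullet> v)) * inverse (partition_fun V x))) (at x within S)"
    using has_derivative_ln[OF partition_fun_pos[OF assms] has_derivative_partition_fun] .
  then show ?thesis
    by (simp add: gibbs_mean_def inner_sum_right mult.commute)
qed

lemma has_derivative_gibbs_mean:
  assumes "finite V" "V \<noteq> {}"
  shows "(gibbs_mean V has_derivative gibbs_cov V x) (at x within S)"
proof -
  define Z where "Z = partition_fun V x"
  have Z: "Z > 0" using partition_fun_pos[OF assms] by (simp add: Z_def)
  have 1: "((\<lambda>x. \<Sum>v\<in>V. exp (x \<bullet> v) *\<^sub>R v) has_derivative
      (\<lambda>h. \<Sum>v\<in>V. (exp (x \<bullet> v) * (h \<bullet> v)) *\<^sub>R v)) (at x within S)"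
    by (auto intro!: derivative_eq_intros simp: mult.commute)
  have 2: "((\<lambda>x. inverse (partition_fun V x)) has_derivative
      (\<lambda>h. - (inverse Z * (\<Sum>v\<in>V. exp (x \<bullet> v) * (h \<bullet> v)) * inverse Z))) (at x within S)"
    using Deriv.has_derivative_inverse[OF _ has_derivative_partition_fun, of V x S] Z
    by (simp add: Z_def)
  have eq: "gibbs_cov V x = (\<lambda>h. inverse Z *\<^sub>R (\<Sum>v\<in>V. (exp (x \<bullet> v) * (h \<bullet> v)) *\<^sub>R v) +
      (- (inverse Z * (\<Sum>v\<in>V. exp (x \<bullet> v) * (h \<bullet> v)) * inverse Z)) *\<^sub>R (\<Sum>v\<in>V. exp (x \<bullet> v) *\<^sub>R v))"
    unfolding gibbs_cov_def gibbs_mean_def Z_def[symmetric]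
    by (auto simp: fun_eq_iff scaleR_sum_right sum_distrib_left sum_distrib_right field_simps sum_negf
        intro!: sum.cong)
  show ?thesis
    unfolding eq gibbs_mean_def [abs_def]
    using has_derivative_scaleR[OF 2 1] by (simp add: Z_def)
qed

text \<open>The quadratic form of a covariance is a variance, here that of
  \<open>h \<bullet> v\<close> under the Gibbs weights. Hence it is nonnegative, and zero only if
  \<open>h \<bullet> v\<close> is constant on \<open>V\<close>.\<close>

lemma inner_gibbs_cov:
  assumes "finite V" "V \<noteq> {}"
  defines "q \<equiv> \<lambda>x v. exp (x \<bullet> v) / partition_fun V x"
  shows "h \<bullet> gibbs_cov V x h = (\<Sum>v\<in>V. q x v * (h \<bullet> v - h \<bullet> gibbs_mean V x)\<^sup>2)"
proof -
  have qa: "exp (x \<bullet> v) / partition_fun V x = q x v" for v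
    by (simp add: q_def)
  have q1: "(\<Sum>v\<in>V. q x v) = 1"
    using partition_fun_pos[OF assms(1,2), of x]
    by (simp add: q_def sum_divide_distrib[symmetric] partition_fun_def)
  have m: "h \<bullet> gibbs_mean V x = (\<Sum>v\<in>V. q x v * (h \<bullet> v))"
    by (simp add: gibbs_mean_def inner_sum_right q_def sum_distrib_left divide_inverse mult_ac)
  define c where "c = h \<bullet> gibbs_mean V x"
  have "(\<Sum>v\<in>V. q x v * (h \<bullet> v - c)\<^sup>2)
      = (\<Sum>v\<in>V. q x v * (h \<bullet> v)\<^sup>2 - 2 * c * (q x v * (h \<bullet> v)) + c\<^sup>2 * q x v)"
    by (intro sum.cong) (auto simp: power2_eq_square algebra_simps)
  also have "\<dots> = (\<Sum>v\<in>V. q x v * (h \<bullet> v)\<^sup>2) - 2 * c * c + c\<^sup>2"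
    by (simp add: sum.distrib sum_subtractf sum_distrib_left[symmetric] q1 m[symmetric] c_def)
  also have "\<dots> = h \<bullet> gibbs_cov V x h"
    unfolding gibbs_cov_def qa m[unfolded c_def[symmetric], symmetric]
    by (simp add: inner_diff_right inner_sum_right c_def[symmetric] power2_eq_square mult.assoc)
  finally show ?thesis by (simp add: c_def)
qed

lemma inner_gibbs_cov_nonneg:
  assumes "finite V" "V \<noteq> {}"
  shows "h \<bullet> gibbs_cov V x h \<ge> 0"
  unfolding inner_gibbs_cov[OF assms] using partition_fun_pos[OF assms, of x]
  by (intro sum_nonneg) auto

lemma inner_gibbs_cov_pos:
  assumes "finite V" "v \<in> V" "w \<in> V" "h \<bullet> v \<noteq> h \<bullet> w"
  shows "h \<bullet> gibbs_cov V x h > 0"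
proof -
  have V: "V \<noteq> {}" using assms by auto
  have "\<exists>u\<in>V. h \<bullet> u \<noteq> h \<bullet> gibbs_mean V x" using assms by metis
  then obtain u where u: "u \<in> V" "h \<bullet> u - h \<bullet> gibbs_mean V x \<noteq> 0" by auto
  show ?thesis
    unfolding inner_gibbs_cov[OF assms(1) V] using partition_fun_pos[OF assms(1) V, of x] u assms(1)
    by (intro sum_pos2[of _ u]) auto
qed

lemma gibbs_mean_in_convex_hull:
  assumes "finite V" "V \<noteq> {}"
  shows "gibbs_mean V x \<in> convex hull V"
proof -
  have "gibbs_mean V x = (\<Sum>v\<in>V. (exp (x \<bullet> v) / partition_fun V x) *\<^sub>R v)"
    by (simp add: gibbs_mean_def scaleR_sum_right divide_inverse mult.commute)
  moreover have "(\<Sum>v\<in>V. exp (x \<bullet> v) / partition_fun V x) = 1"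
    using partition_fun_pos[OF assms, of x]
    by (simp add: sum_divide_distrib[symmetric] partition_fun_def)
  moreover have "(\<Sum>v\<in>V. (exp (x \<bullet> v) / partition_fun V x) *\<^sub>R v) \<in> convex hull V"
    using assms partition_fun_pos[OF assms, of x] calculation(2)
    by (intro convex_sum) (auto intro: hull_inc less_imp_le)
  ultimately show ?thesis by simp
qed

text \<open>On \<open>V\<close> a single exponential is bounded by the whole sum; as the bound
  describes a half-space in \<open>u\<close>, it extends to the convex hull.\<close>

lemma inner_le_ln_partition_fun:
  assumes "finite V" "V \<noteq> {}" "u \<in> convex hull V"
  shows "x \<bullet> u \<le> ln (partition_fun V x)"
proof -
  have "V \<subseteq> {u. x \<bullet> u \<le> ln (partition_fun V x)}"
  proof
    fix v assume "v \<in> V"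
    then have "exp (x \<bullet> v) \<le> partition_fun V x"
      unfolding partition_fun_def using assms(1) by (intro member_le_sum) auto
    then show "v \<in> {u. x \<bullet> u \<le> ln (partition_fun V x)}"
      using partition_fun_pos[OF assms(1,2), of x] by (simp add: ln_ge_iff)
  qed
  then have "convex hull V \<subseteq> {u. x \<bullet> u \<le> ln (partition_fun V x)}"
    by (intro hull_minimal convex_halfspace_le)
  then show ?thesis using assms(3) by auto
qed

section \<open>Gradient maps onto Minkowski sums\<close>

definition mink :: "'a::real_vector set \<Rightarrow> real \<Rightarrow> 'a set \<Rightarrow> 'a set" where
  "mink A b B = {u + b *\<^sub>R w | u w. u \<in> A \<and> w \<in> B}"

lemma compact_mink:
  fixes A B :: "'a::real_normed_vector set"
  assumes "compact A" "compact B"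
  shows "compact (mink A b B)"
proof -
  have "mink A b B = {x + y | x y. x \<in> A \<and> y \<in> (*\<^sub>R) b ` B}"
    by (auto simp: mink_def)
  then show ?thesis using compact_sums[OF assms(1) compact_scaling[OF assms(2)]] by simp
qed

lemma convex_mink:
  assumes "convex A" "convex B"
  shows "convex (mink A b B)"
proof -
  have "mink A b B = (\<Union>x\<in>A. \<Union>y\<in>(*\<^sub>R) b ` B. {x + y})"
    by (auto simp: mink_def)
  then show ?thesis using convex_sums[OF assms(1) convex_scaling[OF assms(2)]] by simp
qed

text \<open>The wanted \<open>x\<close> is a critical point of \<Phi>, whose gradient is the
  left-hand side minus \<open>y\<close>. A ball around \<open>y\<close> inside the Minkowski sum
  makes \<Phi> grow at least like \<open>e * norm x\<close>, so a minimum is attained.\<close>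

lemma gibbs_mean_onto_interior:
  fixes V W :: "'a::euclidean_space set"
  assumes V: "finite V" "V \<noteq> {}" and W: "finite W" "W \<noteq> {}" and b: "b > 0"
    and y: "y \<in> interior (mink (convex hull V) b (convex hull W))"
  shows "\<exists>x. gibbs_mean V x + b *\<^sub>R gibbs_mean W x = y"
proof -
  define C where "C = mink (convex hull V) b (convex hull W)"
  define \<Phi> where "\<Phi> = (\<lambda>x. ln (partition_fun V x) + b * ln (partition_fun W x) - x \<bullet> y)"
  obtain e where e: "e > 0" "cball y e \<subseteq> C"
    using y by (auto simp: C_def mem_interior_cball)
  have lower: "e * norm x \<le> \<Phi> x" for x
  proof (cases "x = 0")
    case True
    have "0 \<bullet> u \<le> ln (partition_fun V 0)" if "u \<in> V" for u
      by (intro inner_le_ln_partition_fun hull_inc V that)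
    moreover have "0 \<bullet> u \<le> ln (partition_fun W 0)" if "u \<in> W" for u
      by (intro inner_le_ln_partition_fun hull_inc W that)
    ultimately show ?thesis using True V W b by (auto simp: \<Phi>_def)
  next
    case False
    \<comment> \<open>The point at distance \<open>e\<close> from \<open>y\<close> in direction
      \<open>x\<close>: its gain over \<open>x \<bullet> y\<close> is exactly
      \<open>e * norm x\<close>.\<close>
    have "y + (e / norm x) *\<^sub>R x \<in> cball y e" using e False by (simp add: dist_norm)
    then have "y + (e / norm x) *\<^sub>R x \<in> C" using e by auto
    then obtain u w where uw: "u \<in> convex hull V" "w \<in> convex hull W"
        "y + (e / norm x) *\<^sub>R x = u + b *\<^sub>R w"
      by (auto simp: C_def mink_def)
    have "x \<bullet> y + e * norm x = x \<bullet> (y + (e / norm x) *\<^sub>R x)"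
      using False by (simp add: inner_add_right dot_square_norm power2_eq_square)
    also have "\<dots> = x \<bullet> u + b * (x \<bullet> w)"
      unfolding uw(3) by (simp add: inner_add_right)
    also have "\<dots> \<le> ln (partition_fun V x) + b * ln (partition_fun W x)"
      using uw b by (intro add_mono mult_left_mono inner_le_ln_partition_fun V W) auto
    finally show ?thesis by (simp add: \<Phi>_def)
  qed
  have der: "(\<Phi> has_derivative (\<lambda>h. h \<bullet> gibbs_mean V x + b * (h \<bullet> gibbs_mean W x) - h \<bullet> y)) (at x)" for x
    unfolding \<Phi>_def
    by (intro derivative_intros has_derivative_ln_partition_fun V W)
  have cont: "continuous_on S \<Phi>" for S
    by (intro has_derivative_continuous_on[OF has_derivative_at_withinI[OF der]])
  \<comment> \<open>Outside the ball of radius \<open>R\<close> the lower bound exceeds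
    \<open>\<Phi> 0\<close>, so a minimum on the ball is global.\<close>
  define R where "R = \<Phi> 0 / e"
  have R: "R \<ge> 0" using lower[of 0] e by (simp add: R_def)
  obtain x0 where x0: "x0 \<in> cball 0 R" "\<And>x. x \<in> cball 0 R \<Longrightarrow> \<Phi> x0 \<le> \<Phi> x"
    using continuous_attains_inf[of "cball 0 R" \<Phi>] cont R by auto
  have min: "\<Phi> x0 \<le> \<Phi> x" for x
  proof (cases "x \<in> cball 0 R")
    case False
    then have "\<Phi> 0 \<le> e * norm x" using e by (simp add: R_def field_simps)
    also note lower[of x]
    finally show ?thesis using x0(2)[of 0] R by simp
  qed (rule x0)
  have "(\<lambda>h. h \<bullet> gibbs_mean V x0 + b * (h \<bullet> gibbs_mean W x0) - h \<bullet> y) = (\<lambda>h. 0)"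
    by (rule differential_zero_maxmin[OF _ open_UNIV der]) (use min in auto)
  then have "h \<bullet> (gibbs_mean V x0 + b *\<^sub>R gibbs_mean W x0 - y) = 0" for h
    by (simp add: fun_eq_iff inner_diff_right inner_add_right)
  then show ?thesis
    by (metis inner_eq_zero_iff eq_iff_diff_eq_0)
qed

text \<open>Along the segment from the identity to \<open>M\<close> the quadratic form stays
  positive, so no matrix on it has a kernel and the determinant cannot change sign.\<close>

lemma det_pos_of_quadratic_form_pos:
  fixes M :: "real^'n^'n"
  assumes pos: "\<And>h. h \<noteq> 0 \<Longrightarrow> h \<bullet> (M *v h) > 0"
  shows "det M > 0"
proof (rule ccontr)
  assume neg: "\<not> det M > 0"
  define N where "N = (\<lambda>s::real. s *\<^sub>R M + (1 - s) *\<^sub>R mat 1)"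
  have cont: "continuous_on {0..1} (\<lambda>s. det (N s))"
    unfolding det_def N_def
    by (intro continuous_intros)
  have "\<exists>s\<ge>0. s \<le> 1 \<and> det (N s) = 0"
    by (rule IVT2'[where f = "\<lambda>s. det (N s)"]) (use cont neg in \<open>auto simp: N_def\<close>)
  then obtain s where s: "0 \<le> s" "s \<le> 1" "det (N s) = 0" by auto
  then obtain h where h: "h \<noteq> 0" "N s *v h = 0"
    using invertible_det_nz[of "N s"] invertible_left_inverse[of "N s"] matrix_left_invertible_ker[of "N s"]
    by auto
  have "0 = h \<bullet> (N s *v h)" using h by simp
  also have "\<dots> = s * (h \<bullet> (M *v h)) + (1 - s) * (h \<bullet> h)"
    by (simp add: N_def matrix_vector_mult_add_rdistrib inner_add_right
        scaleR_matrix_vector_assoc[symmetric])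
  also have "\<dots> > 0"
    using s pos[OF h(1)] h(1)
    by (cases "s = 0") (auto intro!: add_pos_nonneg)
  finally show False by simp
qed

lemma matrix_gibbs_pencil:
  fixes V W :: "(real^'n) set"
  shows "matrix (\<lambda>h. gibbs_cov V x h + b *\<^sub>R gibbs_cov W x h) =
    matrix (gibbs_cov V x) + b *\<^sub>R matrix (gibbs_cov W x)"
  by (simp add: matrix_def vec_eq_iff)

text \<open>
  The gradient of the convex function \<open>ln (partition_fun V) + b * ln (partition_fun W)\<close> maps the
  whole space injectively onto the Minkowski sum up to its boundary, and its Jacobian is a pencil
  in \<open>b\<close>.
\<close>

lemma gibbs_pencil_has_integral:
  fixes V W :: "(real^'m::{finite,wellorder}) set"
  assumes V: "finite V" "V \<noteq> {}" and W: "finite W" "W \<noteq> {}" and b: "b > 0"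
    and span: "\<And>h. h \<noteq> 0 \<Longrightarrow> \<exists>v\<in>W. \<exists>w\<in>W. h \<bullet> v \<noteq> h \<bullet> w"
  shows "((\<lambda>x. det (matrix (gibbs_cov V x) + b *\<^sub>R matrix (gibbs_cov W x)))
    has_integral measure lebesgue (mink (convex hull V) b (convex hull W))) UNIV"
proof -
  define C where "C = mink (convex hull V) b (convex hull W)"
  define F where "F = (\<lambda>x. gibbs_mean V x + b *\<^sub>R gibbs_mean W x)"
  define F' where "F' = (\<lambda>x h. gibbs_cov V x h + b *\<^sub>R gibbs_cov W x h)"
  have der: "(F has_derivative F' x) (at x within S)" for x S
    unfolding F_def F'_def
    by (intro derivative_intros has_derivative_gibbs_mean V W)
  have lin: "linear (F' x)" for x
    using der by (rule has_derivative_linear)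
  \<comment> \<open>\<open>W\<close> lies in no hyperplane, so its covariance is definite; that of
    \<open>V\<close> only adds a nonnegative amount.\<close>
  have pos: "h \<bullet> F' x h > 0" if "h \<noteq> 0" for x h
  proof -
    from span[OF that] obtain v w where "v \<in> W" "w \<in> W" "h \<bullet> v \<noteq> h \<bullet> w" by auto
    then have "h \<bullet> gibbs_cov W x h > 0" using W by (intro inner_gibbs_cov_pos) auto
    then show ?thesis
      using inner_gibbs_cov_nonneg[OF V, of h x] b by (simp add: F'_def inner_add_right add_nonneg_pos)
  qed
  have detpos: "det (matrix (F' x)) > 0" for x
    by (rule det_pos_of_quadratic_form_pos) (use pos lin in \<open>simp add: matrix_works\<close>)
  have inj: "inj F"
  proof (rule injI, rule ccontr)
    fix x y assume eq: "F x = F y" and "x \<noteq> y"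
    define h where "h = y - x"
    have "h \<noteq> 0" using \<open>x \<noteq> y\<close> by (simp add: h_def)
    \<comment> \<open>\<open>h \<bullet> F\<close> increases strictly along the segment from
      \<open>x\<close> to \<open>y\<close>, since its derivative there is the positive quadratic
      form.\<close>
    define g where "g = (\<lambda>s::real. h \<bullet> F (x + s *\<^sub>R h))"
    have "(g has_derivative (\<lambda>t. h \<bullet> F' (x + s *\<^sub>R h) (t *\<^sub>R h))) (at s)" for s
    proof -
      have "((\<lambda>s. x + s *\<^sub>R h) has_derivative (\<lambda>t. t *\<^sub>R h)) (at s)"
        by (auto intro!: derivative_eq_intros)
      from has_derivative_compose[OF this der]
      have "((\<lambda>s. F (x + s *\<^sub>R h)) has_derivative (\<lambda>t. F' (x + s *\<^sub>R h) (t *\<^sub>R h))) (at s)" .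
      then show ?thesis unfolding g_def by (intro derivative_intros)
    qed
    moreover have "(\<lambda>t. h \<bullet> F' (x + s *\<^sub>R h) (t *\<^sub>R h)) = (*) (h \<bullet> F' (x + s *\<^sub>R h) h)" for s
      by (simp add: fun_eq_iff linear_scale[OF lin] mult.commute)
    ultimately have deriv: "(g has_real_derivative (h \<bullet> F' (x + s *\<^sub>R h) h)) (at s)" for s
      by (simp add: has_field_derivative_def)
    have "g 0 < g 1"
    proof (rule DERIV_pos_imp_increasing[where f = g])
      show "\<exists>y. DERIV g s :> y \<and> 0 < y" for s
        using deriv[of s] pos[OF \<open>h \<noteq> 0\<close>, of "x + s *\<^sub>R h"] by blast
    qed simp
    then show False using eq by (simp add: g_def h_def)
  qed
  have "compact C" "convex C"
    unfolding C_def using V W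
    by (auto intro!: compact_mink convex_mink finite_imp_compact_convex_hull convex_convex_hull)
  have sub: "range F \<subseteq> C"
    by (auto simp: F_def C_def mink_def intro!: gibbs_mean_in_convex_hull V W exI)
  have sup: "interior C \<subseteq> range F"
    using gibbs_mean_onto_interior[OF V W b] by (fastforce simp: C_def F_def)
  \<comment> \<open>The range of \<open>F\<close> lies between the interior of \<open>C\<close> and
    \<open>C\<close>, so a null boundary is all that is missing for equal measures.\<close>
  have "negligible (frontier C)" using \<open>convex C\<close> by (rule negligible_convex_frontier)
  then have neg: "negligible (C - range F)" "negligible (range F - C)"
    using sub sup \<open>compact C\<close>
    by (auto simp: frontier_def compact_imp_closed elim!: negligible_subset)
  have C: "C \<in> lmeasurable" using \<open>compact C\<close> by (rule lmeasurable_compact)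
  have "range F \<in> lmeasurable \<and> measure lebesgue (range F) = measure lebesgue C"
    using lmeasurable_negligible_symdiff[OF C, of "range F"] measure_negligible_symdiff[OF C, of "range F"] neg
    by (simp add: negligible_Un)
  then have "((\<lambda>x. \<bar>det (matrix (F' x))\<bar>) has_integral measure lebesgue C) UNIV"
    by (subst has_measure_differentiable_image[OF _ der, symmetric]) (use inj in auto)
  then show ?thesis
    using detpos by (simp add: F'_def matrix_gibbs_pencil C_def abs_of_pos)
qed

lemma interpolated_mink_finite:
  fixes V W :: "(real^'m::{finite,wellorder}) set"
  assumes "finite V" "V \<noteq> {}" "finite W" "W \<noteq> {}"
    and "\<And>h. h \<noteq> 0 \<Longrightarrow> \<exists>v\<in>W. \<exists>w\<in>W. h \<bullet> v \<noteq> h \<bullet> w"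
  shows "interpolated CARD('m) (\<lambda>b. measure lebesgue (mink (convex hull V) b (convex hull W)))"
  by (rule interpolated_integral[OF interpolated_det_pencil gibbs_pencil_has_integral])
    (use assms in auto)

text \<open>
  The change of variables theorem is only available for well-ordered index types; \<open>windex\<close> transports
  it to arbitrary finite ones.
\<close>

typedef 'a windex = "UNIV :: 'a set" by simp

lemma inj_Rep_windex: "inj Rep_windex"
  by (simp add: inj_def Rep_windex_inject)

instance windex :: (finite) finite
  by intro_classes (rule finite_imageD[OF _ inj_Rep_windex], simp)

definition windex_rank :: "'a::finite windex \<Rightarrow> nat" where
  "windex_rank = (SOME f. inj f)"

lemma inj_windex_rank: "inj (windex_rank :: 'a::finite windex \<Rightarrow> nat)"
proof -
  obtain f :: "'a windex \<Rightarrow> nat" where "inj f"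
    using finite_imp_inj_to_nat_seg[of "UNIV :: 'a windex set"] by auto
  then show ?thesis unfolding windex_rank_def by (rule someI[of inj])
qed

instantiation windex :: (finite) wellorder
begin

definition "x \<le> y \<longleftrightarrow> windex_rank x \<le> windex_rank (y :: 'a windex)"
definition "x < y \<longleftrightarrow> windex_rank x < windex_rank (y :: 'a windex)"

instance
proof
  fix x y z :: "'a windex"
  show "x < y \<longleftrightarrow> x \<le> y \<and> \<not> y \<le> x" "x \<le> x" "x \<le> y \<or> y \<le> x"
    by (auto simp: less_eq_windex_def less_windex_def)
  show "x \<le> y \<Longrightarrow> y \<le> z \<Longrightarrow> x \<le> z"
    by (simp add: less_eq_windex_def)
  show "x \<le> y \<Longrightarrow> y \<le> x \<Longrightarrow> x = y"
    unfolding less_eq_windex_def by (rule injD[OF inj_windex_rank]) (rule order.antisym)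
next
  fix P :: "'a windex \<Rightarrow> bool" and a
  assume "\<And>x. (\<And>y. y < x \<Longrightarrow> P y) \<Longrightarrow> P x"
  then show "P a"
    unfolding less_windex_def by (rule measure_induct_rule)
qed

end

definition to_windex :: "real^'n \<Rightarrow> real^'n windex" where
  "to_windex x = (\<chi> i. x $ Rep_windex i)"

definition of_windex :: "real^'n windex \<Rightarrow> real^'n" where
  "of_windex y = (\<chi> i. y $ Abs_windex i)"

lemma of_windex_to_windex [simp]: "of_windex (to_windex x) = x"
  by (simp add: of_windex_def to_windex_def Abs_windex_inverse vec_eq_iff)

lemma to_windex_of_windex [simp]: "to_windex (of_windex y) = y"
  by (simp add: of_windex_def to_windex_def Rep_windex_inverse vec_eq_iff)

lemma linear_to_windex: "linear to_windex"
  by (rule linearI) (simp_all add: to_windex_def vec_eq_iff)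

lemma linear_of_windex: "linear of_windex"
  by (rule linearI) (simp_all add: of_windex_def vec_eq_iff)

lemma bij_Rep_windex: "bij Rep_windex"
  by (metis Rep_windex_inverse Abs_windex_inverse UNIV_I bijI')

lemma CARD_windex: "CARD('a windex) = CARD('a)"
  using bij_betw_same_card[OF bij_Rep_windex] .

lemma inner_to_windex: "h \<bullet> to_windex x = of_windex h \<bullet> x"
  unfolding inner_vec_def to_windex_def of_windex_def
  by (simp, rule sum.reindex_bij_witness[of _ Abs_windex Rep_windex])
    (auto simp: Rep_windex_inverse Abs_windex_inverse)

lemma emeasure_lborel_box_cart:
  fixes l u :: "real^'n"
  assumes "\<And>i. l $ i \<le> u $ i"
  shows "emeasure lborel (box l u) = (\<Prod>i\<in>UNIV. ennreal (u $ i - l $ i))"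
proof -
  have "cbox l u \<noteq> {}" using assms by (auto simp: interval_ne_empty_cart)
  then have "(\<Prod>b\<in>Basis. (u - l) \<bullet> b) = (\<Prod>i\<in>UNIV. u $ i - l $ i)"
    using content_cbox_cart[of l u] content_cbox'[of l u] by (simp add: inner_diff_left)
  moreover have "l \<bullet> b \<le> u \<bullet> b" if "b \<in> Basis" for b
    using that assms by (auto simp: Basis_vec_def inner_axis)
  ultimately show ?thesis
    using assms by (simp add: emeasure_lborel_box_eq prod_ennreal)
qed

text \<open>Reindexing permutes the sides of a box and so keeps its volume; volumes of boxes
  determine Lebesgue measure.\<close>

lemma distr_of_windex: "distr lborel borel of_windex = (lborel :: (real^'n) measure)"
proof (rule lborel_eqI[symmetric])
  fix l u :: "real^'n"
  assume le: "\<And>b. b \<in> Basis \<Longrightarrow> l \<bullet> b \<le> u \<bullet> b"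
  have lu: "l $ i \<le> u $ i" for i
    using le[of "axis i 1"] by (simp add: inner_axis axis_in_Basis_iff)
  have [measurable]: "of_windex \<in> borel_measurable borel"
    by (intro borel_measurable_continuous_onI linear_continuous_on linear_linear[THEN iffD2]
        linear_conv_bounded_linear[THEN iffD1] linear_of_windex)
  have "of_windex -` box l u = box (to_windex l) (to_windex u)"
  proof -
    have "(\<forall>i. l $ i < y $ Abs_windex i \<and> y $ Abs_windex i < u $ i)
        \<longleftrightarrow> (\<forall>i. l $ Rep_windex i < y $ i \<and> y $ i < u $ Rep_windex i)" for y
      by (metis Rep_windex_inverse Abs_windex_inverse UNIV_I)
    then show ?thesis by (auto simp: mem_box_cart of_windex_def to_windex_def)
  qed
  then have "emeasure (distr lborel borel of_windex) (box l u)
      = emeasure lborel (box (to_windex l) (to_windex u))"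
    by (simp add: emeasure_distr)
  also have "\<dots> = (\<Prod>i\<in>UNIV. ennreal (u $ Rep_windex i - l $ Rep_windex i))"
    by (subst emeasure_lborel_box_cart) (auto simp: to_windex_def lu)
  also have "\<dots> = (\<Prod>i\<in>UNIV. ennreal (u $ i - l $ i))"
    by (rule prod.reindex_bij_betw[OF bij_Rep_windex])
  also have "\<dots> = emeasure lborel (box l u)"
    by (subst emeasure_lborel_box_cart) (auto simp: lu)
  finally show "emeasure (distr lborel borel of_windex) (box l u) = ennreal (\<Prod>b\<in>Basis. (u - l) \<bullet> b)"
    using le by (simp add: emeasure_lborel_box_eq)
qed simp

lemma measure_to_windex_image:
  fixes S :: "(real^'n) set"
  assumes "S \<in> sets borel"
  shows "measure lborel (to_windex ` S) = measure lborel S"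
proof -
  have [measurable]: "of_windex \<in> borel_measurable borel"
    by (intro borel_measurable_continuous_onI linear_continuous_on
        linear_conv_bounded_linear[THEN iffD1] linear_of_windex)
  have "to_windex ` S = of_windex -` S"
    by (auto simp: image_iff) (metis to_windex_of_windex)
  moreover have "measure (distr lborel borel of_windex) S = measure lborel (of_windex -` S)"
    using assms by (subst measure_distr) auto
  ultimately show ?thesis by (simp add: distr_of_windex)
qed

lemma mink_linear_image:
  assumes "linear f"
  shows "mink (f ` A) b (f ` B) = f ` mink A b B"
proof -
  have "f (u + b *\<^sub>R w) = f u + b *\<^sub>R f w" for u w
    using assms by (simp add: linear_add linear_scale)
  then show ?thesis by (auto simp: mink_def image_iff) metis+
qed

lemma interpolated_mink_hull:
  fixes V W :: "(real^'n) set"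
  assumes "finite V" "V \<noteq> {}" "finite W" "W \<noteq> {}"
    and span: "\<And>h. h \<noteq> 0 \<Longrightarrow> \<exists>v\<in>W. \<exists>w\<in>W. h \<bullet> v \<noteq> h \<bullet> w"
  shows "interpolated CARD('n) (\<lambda>b. measure lborel (mink (convex hull V) b (convex hull W)))"
proof -
  have cpt: "compact (mink (convex hull V) b (convex hull W))" for b
    using assms by (intro compact_mink finite_imp_compact_convex_hull)
  have "interpolated CARD('n windex)
      (\<lambda>b. measure lebesgue (mink (convex hull to_windex ` V) b (convex hull to_windex ` W)))"
  proof (rule interpolated_mink_finite)
    fix h :: "real^'n windex" assume "h \<noteq> 0"
    then have "of_windex h \<noteq> 0"
      by (metis to_windex_of_windex linear_0 linear_to_windex)
    from span[OF this] show "\<exists>v\<in>to_windex ` W. \<exists>w\<in>to_windex ` W. h \<bullet> v \<noteq> h \<bullet> w"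
      by (auto simp: inner_to_windex)
  qed (use assms in auto)
  moreover have "mink (convex hull to_windex ` V) b (convex hull to_windex ` W)
      = to_windex ` mink (convex hull V) b (convex hull W)" for b
    by (simp add: mink_linear_image[OF linear_to_windex] convex_hull_linear_image[OF linear_to_windex, symmetric])
  moreover have "measure lebesgue (to_windex ` mink (convex hull V) b (convex hull W))
      = measure lborel (mink (convex hull V) b (convex hull W))" for b
  proof -
    have "compact (to_windex ` mink (convex hull V) b (convex hull W))"
      by (intro compact_continuous_image linear_continuous_on cpt
          linear_conv_bounded_linear[THEN iffD1] linear_to_windex)
    then show ?thesis
      using measure_to_windex_image[of "mink (convex hull V) b (convex hull W)"] cpt[of b]
      by (simp add: borel_compact)
  qed
  ultimately show ?thesis by (simp add: CARD_windex)
qed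

section \<open>From polytopes to convex bodies\<close>

lemma convex_Union_incseq:
  fixes M :: "nat \<Rightarrow> 'a::real_vector set"
  assumes "incseq M" "\<And>k. convex (M k)"
  shows "convex (\<Union>k. M k)"
proof (rule convexI)
  fix x y and u v :: real
  assume "x \<in> (\<Union>k. M k)" "y \<in> (\<Union>k. M k)" and uv: "0 \<le> u" "0 \<le> v" "u + v = 1"
  then obtain k l where "x \<in> M k" "y \<in> M l" by auto
  then have "x \<in> M (max k l)" "y \<in> M (max k l)"
    using incseqD[OF assms(1), of k "max k l"] incseqD[OF assms(1), of l "max k l"] by auto
  then have "u *\<^sub>R x + v *\<^sub>R y \<in> M (max k l)"
    using convexD[OF assms(2)] uv by blast
  then show "u *\<^sub>R x + v *\<^sub>R y \<in> (\<Union>k. M k)" by auto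
qed

text \<open>
  Both bodies are exhausted by polytopes spanned by finitely many points of countable dense subsets.
\<close>

proposition interpolated_mink:
  fixes A B :: "(real^'n) set"
  assumes A: "compact A" "convex A" "A \<noteq> {}" and B: "compact B" "convex B" "interior B \<noteq> {}"
  shows "interpolated CARD('n) (\<lambda>b. measure lborel (mink A b B))"
proof -
  obtain S where S: "countable S" "S \<subseteq> A" "A \<subseteq> closure S" using separable by blast
  obtain T where T: "countable T" "T \<subseteq> B" "B \<subseteq> closure T" using separable by blast
  have ne: "S \<noteq> {}" "T \<noteq> {}" using S T A B interior_subset by auto
  obtain c r where c: "r > 0" "cball c r \<subseteq> B"
    using B(3) by (meson ex_in_conv mem_interior_cball)
  \<comment> \<open>The vertices of a small full-dimensional simplex inside \<open>B\<close>. They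
    are kept in every \<open>W k\<close>, so that no approximating vertex set lies in a
    hyperplane.\<close>
  define W0 where "W0 = insert c ((\<lambda>e. c + r *\<^sub>R e) ` Basis)"
  have W0: "finite W0" "W0 \<subseteq> B" using c by (auto simp: W0_def dist_norm subset_iff)
  define V where "V = (\<lambda>k. from_nat_into S ` {..k::nat})"
  define W where "W = (\<lambda>k. W0 \<union> from_nat_into T ` {..k::nat})"
  have V: "finite (V k)" "V k \<noteq> {}" "V k \<subseteq> A" for k
    using from_nat_into[OF ne(1)] S by (auto simp: V_def)
  have W: "finite (W k)" "W k \<noteq> {}" "W k \<subseteq> B" for k
    using from_nat_into[OF ne(2)] T W0 by (auto simp: W_def)
  define M where "M = (\<lambda>b k. mink (convex hull (V k)) b (convex hull (W k)))"
  have interp: "interpolated CARD('n) (\<lambda>b. measure lborel (M b k))" for k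
    unfolding M_def
  proof (rule interpolated_mink_hull)
    fix h :: "real^'n" assume "h \<noteq> 0"
    then obtain e where e: "e \<in> Basis" "h \<bullet> e \<noteq> 0" by (metis euclidean_all_zero_iff)
    have "c \<in> W k" "c + r *\<^sub>R e \<in> W k" using e by (auto simp: W_def W0_def)
    moreover have "h \<bullet> c \<noteq> h \<bullet> (c + r *\<^sub>R e)" using e c by (simp add: inner_add_right)
    ultimately show "\<exists>v\<in>W k. \<exists>w\<in>W k. h \<bullet> v \<noteq> h \<bullet> w" by blast
  qed (use V W in auto)
  have "(\<lambda>k. measure lborel (M b k)) \<longlonglongrightarrow> measure lborel (mink A b B)" for b
  proof -
    define U where "U = (\<Union>k. M b k)"
    have inc: "incseq (M b)"
      unfolding incseq_def
    proof (intro allI impI)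
      fix k l :: nat assume "k \<le> l"
      then have "V k \<subseteq> V l" "W k \<subseteq> W l" by (auto simp: V_def W_def)
      then have "convex hull (V k) \<subseteq> convex hull (V l)" "convex hull (W k) \<subseteq> convex hull (W l)"
        by (auto intro!: hull_mono)
      then show "M b k \<subseteq> M b l" by (auto simp: M_def mink_def)
    qed
    have cpt: "compact (M b k)" for k
      unfolding M_def using V W by (intro compact_mink finite_imp_compact_convex_hull)
    have sub: "U \<subseteq> mink A b B"
    proof -
      have "convex hull (V k) \<subseteq> A" "convex hull (W k) \<subseteq> B" for k
        by (intro hull_minimal V W A B)+
      then show ?thesis by (force simp: U_def M_def mink_def)
    qed
    have "convex U"
      unfolding U_def using inc
      by (intro convex_Union_incseq) (auto simp: M_def intro!: convex_mink convex_convex_hull)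
    have "u + b *\<^sub>R w \<in> U" if "u \<in> S" "w \<in> T" for u w
    proof -
      have "u \<in> range (from_nat_into S)" "w \<in> range (from_nat_into T)"
        using that S(1) T(1) ne by (simp_all add: range_from_nat_into)
      then obtain k l where "u = from_nat_into S k" "w = from_nat_into T l" by auto
      then have "u \<in> V (max k l)" "w \<in> W (max k l)" by (auto simp: V_def W_def)
      then have "u \<in> convex hull V (max k l)" "w \<in> convex hull W (max k l)"
        by (simp_all add: hull_inc)
      then have "u + b *\<^sub>R w \<in> M b (max k l)" unfolding M_def mink_def by blast
      then show ?thesis by (auto simp: U_def)
    qed
    note sums = this
    have dense: "u + b *\<^sub>R w \<in> closure U" if "u \<in> A" "w \<in> B" for u w
    proof -
      have uw: "u \<in> closure S" "w \<in> closure T" using that S(3) T(3) by auto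
      obtain f where f: "\<And>n. f n \<in> S" "f \<longlonglongrightarrow> u"
        using uw(1) unfolding closure_sequential by blast
      obtain g where g: "\<And>n. g n \<in> T" "g \<longlonglongrightarrow> w"
        using uw(2) unfolding closure_sequential by blast
      have "(\<lambda>n. f n + b *\<^sub>R g n) \<longlonglongrightarrow> u + b *\<^sub>R w" by (intro tendsto_intros f g)
      moreover have "f n + b *\<^sub>R g n \<in> U" for n by (rule sums[OF f(1) g(1)])
      ultimately show ?thesis
        unfolding closure_sequential by (intro exI[of _ "\<lambda>n. f n + b *\<^sub>R g n"]) simp
    qed
    have "mink A b B \<subseteq> closure U" using dense by (auto simp: mink_def)
    \<comment> \<open>A convex set and its closure have the same interior, so the dense convex union
      \<open>U\<close> misses at most boundary points of the limit body.\<close>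
    then have "interior (mink A b B) \<subseteq> U"
      using interior_mono convex_interior_closure[OF \<open>convex U\<close>] interior_subset by blast
    have cm: "compact (mink A b B)" using A B by (intro compact_mink)
    have "negligible (frontier (mink A b B))"
      using A B by (intro negligible_convex_frontier convex_mink)
    then have neg: "negligible (mink A b B - U)"
      using \<open>interior (mink A b B) \<subseteq> U\<close> cm
      by (auto simp: frontier_def compact_imp_closed elim!: negligible_subset)
    have U: "U \<in> sets borel"
      unfolding U_def using cpt by (intro sets.countable_UN image_subsetI borel_compact)
    have "measure lebesgue U = measure lebesgue (mink A b B)"
      using measure_negligible_symdiff[OF lmeasurable_compact[OF cm], of U] neg sub
      by (simp add: Diff_eq_empty_iff)
    then have meas: "measure lborel U = measure lborel (mink A b B)"
      using U cm by (simp add: borel_compact)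
    have "emeasure lborel U \<le> emeasure lborel (mink A b B)"
      using sub cm by (intro emeasure_mono) (auto intro: borel_compact)
    also have "\<dots> < \<infinity>" using compact_imp_bounded[OF cm] by (rule emeasure_bounded_finite)
    finally have "(\<lambda>k. measure lborel (M b k)) \<longlonglongrightarrow> measure lborel U"
      unfolding U_def using cpt inc by (intro Lim_measure_incseq) (auto intro: borel_compact)
    then show ?thesis by (simp add: meas)
  qed
  then show ?thesis by (intro interpolated_LIMSEQ[OF interp])
qed

section \<open>The body \<open>a K\<^sup>p - b \<Delta>\<^sub>p K\<close>\<close>

abbreviation lborel_power :: "nat \<Rightarrow> (nat \<Rightarrow> real^'n) measure" where
  "lborel_power p \<equiv> \<Pi>\<^sub>M i\<in>{..<p}. lborel"

interpretation lborel_product: product_sigma_finite "\<lambda>i::nat. lborel :: (real^'n) measure" ..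

text \<open>The rescaled image measure is compared with the product measure on product sets, where
  the scaling factor occurs once for each of the \<open>card I\<close> factors.\<close>

lemma nn_integral_PiM_lborel_affine:
  fixes t :: "nat \<Rightarrow> real^'n"
  assumes c: "c > 0" and I: "finite I" and [measurable]: "g \<in> borel_measurable (\<Pi>\<^sub>M i\<in>I. lborel)"
  shows "(\<integral>\<^sup>+z. g z \<partial>(\<Pi>\<^sub>M i\<in>I. lborel)) =
    ennreal c ^ (CARD('n) * card I) * (\<integral>\<^sup>+z. g (\<lambda>i\<in>I. t i + c *\<^sub>R z i) \<partial>(\<Pi>\<^sub>M i\<in>I. lborel))"
proof -
  let ?M = "\<Pi>\<^sub>M i\<in>I. (lborel :: (real^'n) measure)"
  define \<phi> where "\<phi> = (\<lambda>z :: nat \<Rightarrow> real^'n. \<lambda>i\<in>I. t i + c *\<^sub>R z i)"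
  have [measurable]: "\<phi> \<in> measurable ?M ?M" unfolding \<phi>_def by measurable
  define r where "r = ennreal c ^ (CARD('n) * card I)"
  have lb: "ennreal c ^ CARD('n) * emeasure lborel ((\<lambda>x. s + c *\<^sub>R x) -` A) = emeasure lborel A"
    if [measurable]: "A \<in> sets borel" for A and s :: "real^'n"
  proof -
    have "emeasure lborel A = emeasure (density (distr lborel borel (\<lambda>x. s + c *\<^sub>R x)) (\<lambda>_. \<bar>c\<bar>^CARD('n))) A"
      using lborel_affine[of c s] c by simp
    also have "\<dots> = ennreal c ^ CARD('n) * emeasure lborel ((\<lambda>x. s + c *\<^sub>R x) -` A)"
      using c by (simp add: emeasure_density_const emeasure_distr ennreal_power)
    finally show ?thesis by simp
  qed
  have "scale_measure r (distr ?M ?M \<phi>) = ?M"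
  proof (rule lborel_product.PiM_eqI[OF I])
    fix A :: "nat \<Rightarrow> (real^'n) set"
    assume A: "\<And>i. i \<in> I \<Longrightarrow> A i \<in> sets lborel"
    then have [measurable]: "Pi\<^sub>E I A \<in> sets ?M" using I by (intro sets_PiM_I_finite) auto
    have sub: "(\<lambda>x. t i + c *\<^sub>R x) -` A i \<in> sets lborel" if "i \<in> I" for i
      using measurable_sets[of "\<lambda>x. t i + c *\<^sub>R x" lborel lborel "A i"] A[OF that] by simp
    have "\<phi> -` (Pi\<^sub>E I A) \<inter> space ?M = (\<Pi>\<^sub>E i\<in>I. (\<lambda>x. t i + c *\<^sub>R x) -` A i)"
      by (auto simp: \<phi>_def space_PiM PiE_iff)
    then have "emeasure (scale_measure r (distr ?M ?M \<phi>)) (Pi\<^sub>E I A)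
        = r * emeasure ?M (\<Pi>\<^sub>E i\<in>I. (\<lambda>x. t i + c *\<^sub>R x) -` A i)"
      by (simp add: emeasure_distr)
    also have "\<dots> = r * (\<Prod>i\<in>I. emeasure lborel ((\<lambda>x. t i + c *\<^sub>R x) -` A i))"
      using sub by (subst lborel_product.emeasure_PiM[OF I]) auto
    also have "\<dots> = (\<Prod>i\<in>I. ennreal c ^ CARD('n) * emeasure lborel ((\<lambda>x. t i + c *\<^sub>R x) -` A i))"
      by (simp add: prod.distrib r_def power_mult)
    also have "\<dots> = (\<Prod>i\<in>I. emeasure lborel (A i))"
      using A by (intro prod.cong refl lb) simp
    finally show "emeasure (scale_measure r (distr ?M ?M \<phi>)) (Pi\<^sub>E I A) = (\<Prod>i\<in>I. emeasure lborel (A i))" .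
  qed simp
  then have "(\<integral>\<^sup>+z. g z \<partial>?M) = (\<integral>\<^sup>+z. g z \<partial>scale_measure r (distr ?M ?M \<phi>))" by simp
  also have "\<dots> = r * (\<integral>\<^sup>+z. g (\<phi> z) \<partial>?M)"
    by (subst nn_integral_scale_measure) (simp_all add: nn_integral_distr)
  finally show ?thesis by (simp add: r_def \<phi>_def)
qed

text \<open>Membership in \<open>a K^p - b \<Delta>_p K\<close>, cleared of subtraction and division
  so that \<open>a = 0\<close> and \<open>b = 0\<close> are ordinary cases. As a predicate it also
  applies to functions that are not extensional.\<close>

definition hits :: "nat \<Rightarrow> real \<Rightarrow> real \<Rightarrow> (real^'n) set \<Rightarrow> (nat \<Rightarrow> real^'n) \<Rightarrow> bool" where
  "hits p a b K z \<longleftrightarrow> (\<exists>x\<in>K. \<forall>i<p. \<exists>y\<in>K. z i + b *\<^sub>R x = a *\<^sub>R y)"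

definition pdiff :: "nat \<Rightarrow> real \<Rightarrow> real \<Rightarrow> (real^'n) set \<Rightarrow> (nat \<Rightarrow> real^'n) set" where
  "pdiff p a b K = {z \<in> extensional {..<p}. hits p a b K z}"

lemma space_lborel_power: "space (lborel_power p) = extensional {..<p}"
  by (auto simp: space_PiM PiE_def)

lemma pdiff_eq_space: "pdiff p a b K = {z \<in> space (lborel_power p). hits p a b K z}"
  by (simp add: pdiff_def space_lborel_power)

text \<open>
  The right-hand side involves only countably many conditions on \<open>z\<close>, hence measurability.
\<close>

lemma hits_iff_dense:
  fixes K :: "(real^'n) set"
  assumes K: "compact K" and X: "X \<subseteq> K" "K \<subseteq> closure X"
  shows "hits p a b K z \<longleftrightarrow>
    (\<forall>m::nat. \<exists>x\<in>X. \<forall>i<p. \<exists>y\<in>X. norm (z i + b *\<^sub>R x - a *\<^sub>R y) < 1 / (real m + 1))"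
proof
  assume "hits p a b K z"
  then obtain x where x: "x \<in> K" "\<And>i. i < p \<Longrightarrow> \<exists>y\<in>K. z i + b *\<^sub>R x = a *\<^sub>R y"
    by (auto simp: hits_def)
  show "\<forall>m::nat. \<exists>x\<in>X. \<forall>i<p. \<exists>y\<in>X. norm (z i + b *\<^sub>R x - a *\<^sub>R y) < 1 / (real m + 1)"
  proof
    fix m :: nat
    \<comment> \<open>Half of the tolerance pays for moving \<open>x\<close> into \<open>X\<close>,
      half for moving \<open>y\<close>.\<close>
    define e where "e = 1 / (real m + 1) / 2"
    have e: "e > 0" by (simp add: e_def)
    have near: "\<exists>v\<in>X. norm (s *\<^sub>R (v - u)) < e" if "u \<in> K" for u and s :: real
    proof -
      have "e / (\<bar>s\<bar> + 1) > 0" using e by simp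
      moreover have "u \<in> closure X" using X that by auto
      ultimately obtain v where v: "v \<in> X" "dist v u < e / (\<bar>s\<bar> + 1)"
        unfolding closure_approachable by blast
      have "norm (s *\<^sub>R (v - u)) \<le> (\<bar>s\<bar> + 1) * dist v u"
        by (simp add: dist_norm distrib_right)
      also have "\<dots> < e" using v by (simp add: field_simps)
      finally show ?thesis using v by blast
    qed
    from near[OF x(1), of b] obtain x' where x': "x' \<in> X" "norm (b *\<^sub>R (x' - x)) < e" by blast
    have "\<exists>y\<in>X. norm (z i + b *\<^sub>R x' - a *\<^sub>R y) < 1 / (real m + 1)" if "i < p" for i
    proof -
      from x(2)[OF that] obtain y where y: "y \<in> K" "z i + b *\<^sub>R x = a *\<^sub>R y" by blast
      from near[OF y(1), of a] obtain y' where y': "y' \<in> X" "norm (a *\<^sub>R (y' - y)) < e" by blast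
      have "z i + b *\<^sub>R x' - a *\<^sub>R y' = b *\<^sub>R (x' - x) - a *\<^sub>R (y' - y)"
        using y(2) by (simp add: algebra_simps)
      then have "norm (z i + b *\<^sub>R x' - a *\<^sub>R y') < e + e"
        using norm_triangle_ineq4[of "b *\<^sub>R (x' - x)" "a *\<^sub>R (y' - y)"] x'(2) y'(2) by simp
      also have "e + e = 1 / (real m + 1)" by (simp add: e_def field_simps)
      finally show ?thesis using y'(1) by blast
    qed
    then show "\<exists>x\<in>X. \<forall>i<p. \<exists>y\<in>X. norm (z i + b *\<^sub>R x - a *\<^sub>R y) < 1 / (real m + 1)"
      using x'(1) by blast
  qed
next
  assume *: "\<forall>m::nat. \<exists>x\<in>X. \<forall>i<p. \<exists>y\<in>X. norm (z i + b *\<^sub>R x - a *\<^sub>R y) < 1 / (real m + 1)"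
  obtain x where x: "\<And>m. x m \<in> X"
      "\<And>m i. i < p \<Longrightarrow> \<exists>y\<in>X. norm (z i + b *\<^sub>R x m - a *\<^sub>R y) < 1 / (real m + 1)"
    using choice[OF *[unfolded Bex_def]] by blast
  have "\<And>m. x m \<in> K" using x X by auto
  then obtain l r where l: "l \<in> K" "strict_mono r" "(x \<circ> r) \<longlonglongrightarrow> l"
    using K unfolding compact_def by metis
  have "\<exists>y\<in>K. z i + b *\<^sub>R l = a *\<^sub>R y" if "i < p" for i
  proof -
    have "\<forall>m. \<exists>y. y \<in> X \<and> norm (z i + b *\<^sub>R x m - a *\<^sub>R y) < 1 / (real m + 1)"
      using x(2)[OF that] by blast
    then obtain y where y: "\<And>m. y m \<in> X" "\<And>m. norm (z i + b *\<^sub>R x m - a *\<^sub>R y m) < 1 / (real m + 1)"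
      using choice by metis
    have "(\<lambda>m. z i + b *\<^sub>R x m - a *\<^sub>R y m) \<longlonglongrightarrow> 0"
    proof (rule Lim_null_comparison)
      show "\<forall>\<^sub>F m in sequentially. norm (z i + b *\<^sub>R x m - a *\<^sub>R y m) \<le> 1 / (real m + 1)"
        using y(2) by (intro always_eventually allI less_imp_le)
      show "(\<lambda>m. 1 / (real m + 1)) \<longlonglongrightarrow> 0"
        using LIMSEQ_inverse_real_of_nat by (simp add: inverse_eq_divide add.commute)
    qed
    then have "(\<lambda>m. z i + b *\<^sub>R x (r m) - a *\<^sub>R y (r m)) \<longlonglongrightarrow> 0"
      using LIMSEQ_subseq_LIMSEQ[OF _ l(2), of "\<lambda>m. z i + b *\<^sub>R x m - a *\<^sub>R y m"] by (simp add: o_def)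
    moreover have "(\<lambda>m. z i + b *\<^sub>R x (r m)) \<longlonglongrightarrow> z i + b *\<^sub>R l"
      using l(3) by (intro tendsto_intros) (simp add: o_def)
    ultimately have "(\<lambda>m. (z i + b *\<^sub>R x (r m)) - (z i + b *\<^sub>R x (r m) - a *\<^sub>R y (r m))) \<longlonglongrightarrow> z i + b *\<^sub>R l - 0"
      by (intro tendsto_diff)
    \<comment> \<open>The points \<open>y (r m)\<close> need not converge, but their multiples by
      \<open>a\<close> do, and the limit stays in the compact set \<open>a K\<close>.\<close>
    then have lim: "(\<lambda>m. a *\<^sub>R y (r m)) \<longlonglongrightarrow> z i + b *\<^sub>R l" by simp
    have "closed ((*\<^sub>R) a ` K)" using K by (intro compact_imp_closed compact_scaling)
    moreover have "a *\<^sub>R y (r m) \<in> (*\<^sub>R) a ` K" for m using y(1) X by auto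
    ultimately have "z i + b *\<^sub>R l \<in> (*\<^sub>R) a ` K"
      by (rule closed_sequentially[OF _ _ lim])
    then show ?thesis by auto
  qed
  then show "hits p a b K z" using l(1) by (auto simp: hits_def)
qed

text \<open>The coefficients are measurable functions too: in the integral inequality they depend on
  \<open>u\<close>, and Fubini needs joint measurability in \<open>z\<close> and
  \<open>u\<close>.\<close>

lemma measurable_hits [measurable (raw)]:
  fixes K :: "(real^'n) set"
  assumes K: "compact K"
    and [measurable]: "a \<in> borel_measurable M" "b \<in> borel_measurable M"
    and z: "\<And>i. i < p \<Longrightarrow> (\<lambda>\<omega>. z \<omega> i) \<in> borel_measurable M"
  shows "Measurable.pred M (\<lambda>\<omega>. hits p (a \<omega>) (b \<omega>) K (z \<omega>))"
proof -
  obtain X where X: "countable X" "X \<subseteq> K" "K \<subseteq> closure X" using separable by blast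
  have [measurable]: "Measurable.pred M (\<lambda>\<omega>. norm (z \<omega> i + b \<omega> *\<^sub>R x - a \<omega> *\<^sub>R y) < 1 / (real m + 1))"
    if "i \<in> {..<p}" for i x y and m :: nat
  proof -
    have [measurable]: "(\<lambda>\<omega>. z \<omega> i) \<in> borel_measurable M" using z that by simp
    show ?thesis by measurable
  qed
  have "Measurable.pred M (\<lambda>\<omega>. \<forall>m::nat. \<exists>x\<in>X. \<forall>i\<in>{..<p}. \<exists>y\<in>X.
      norm (z \<omega> i + b \<omega> *\<^sub>R x - a \<omega> *\<^sub>R y) < 1 / (real m + 1))"
    using X(1) by (intro pred_intros_countable pred_intros_countable_bounded) auto
  then show ?thesis by (simp add: hits_iff_dense[OF K X(2,3)] Ball_def)
qed

lemma sets_pdiff [measurable]: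
  assumes "compact K"
  shows "pdiff p a b K \<in> sets (lborel_power p)"
proof -
  have "Measurable.pred (lborel_power p) (\<lambda>z. hits p a b K z)"
    by (intro measurable_hits assms) measurable
  then show ?thesis unfolding pdiff_eq_space by simp
qed

lemma emeasure_pdiff_finite:
  fixes K :: "(real^'n) set"
  assumes "compact K"
  shows "emeasure (lborel_power p) (pdiff p a b K) < \<infinity>"
proof -
  obtain R where R: "\<And>x. x \<in> K \<Longrightarrow> norm x \<le> R"
    using compact_imp_bounded[OF assms] by (auto simp: bounded_iff)
  define C where "C = cball (0::real^'n) (\<bar>a\<bar> * R + \<bar>b\<bar> * R)"
  have "pdiff p a b K \<subseteq> (\<Pi>\<^sub>E i\<in>{..<p}. C)"
  proof
    fix z assume "z \<in> pdiff p a b K"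
    then obtain x where z: "z \<in> extensional {..<p}" and x: "x \<in> K" "\<And>i. i < p \<Longrightarrow> \<exists>y\<in>K. z i + b *\<^sub>R x = a *\<^sub>R y"
      by (auto simp: pdiff_def hits_def)
    have "z i \<in> C" if "i < p" for i
    proof -
      from x(2)[OF that] obtain y where y: "y \<in> K" "z i + b *\<^sub>R x = a *\<^sub>R y" by blast
      then have "z i = a *\<^sub>R y - b *\<^sub>R x" by (simp add: algebra_simps)
      then have "norm (z i) \<le> \<bar>a\<bar> * norm y + \<bar>b\<bar> * norm x"
        using norm_triangle_ineq4[of "a *\<^sub>R y" "b *\<^sub>R x"] by simp
      also have "\<dots> \<le> \<bar>a\<bar> * R + \<bar>b\<bar> * R"
        using R x(1) y(1) by (intro add_mono mult_left_mono) auto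
      finally show ?thesis by (simp add: C_def)
    qed
    then show "z \<in> (\<Pi>\<^sub>E i\<in>{..<p}. C)" using z by (auto simp: PiE_iff)
  qed
  then have "emeasure (lborel_power p) (pdiff p a b K) \<le> emeasure (lborel_power p) (\<Pi>\<^sub>E i\<in>{..<p}. C)"
    by (intro emeasure_mono sets_PiM_I_finite) (auto simp: C_def)
  also have "\<dots> = (\<Prod>i\<in>{..<p}. emeasure lborel C)"
    by (intro lborel_product.emeasure_PiM) (auto simp: C_def)
  also have "\<dots> < \<infinity>"
    using emeasure_bounded_finite[of C]
    by (simp add: C_def power_less_top_ennreal)
  finally show ?thesis .
qed

lemma vol_power_pdiff_scale:
  fixes K :: "(real^'n) set"
  assumes "compact K" "c > 0"
  shows "vol_power p (pdiff p (c * a) (c * b) K) = c ^ (CARD('n) * p) * vol_power p (pdiff p a b K)"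
proof -
  let ?M = "lborel_power p :: (nat \<Rightarrow> real^'n) measure"
  note [measurable] = sets_pdiff[OF assms(1)]
  have eq: "(\<lambda>i\<in>{..<p}. 0 + c *\<^sub>R z i) \<in> pdiff p (c * a) (c * b) K \<longleftrightarrow> z \<in> pdiff p a b K"
    if "z \<in> space ?M" for z
  proof -
    have "c *\<^sub>R u + (c * b) *\<^sub>R x = (c * a) *\<^sub>R y \<longleftrightarrow> u + b *\<^sub>R x = a *\<^sub>R y" for u x y :: "real^'n"
      using assms(2) by (simp flip: scaleR_scaleR scaleR_add_right)
    then show ?thesis using that by (simp add: pdiff_def hits_def space_lborel_power)
  qed
  have "emeasure ?M (pdiff p (c * a) (c * b) K) = (\<integral>\<^sup>+z. indicator (pdiff p (c * a) (c * b) K) z \<partial>?M)"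
    by simp
  also have "\<dots> = ennreal c ^ (CARD('n) * p) *
      (\<integral>\<^sup>+z. indicator (pdiff p (c * a) (c * b) K) (\<lambda>i\<in>{..<p}. 0 + c *\<^sub>R z i) \<partial>?M)"
    by (subst nn_integral_PiM_lborel_affine[OF assms(2), where t = "\<lambda>_. 0"]) simp_all
  also have "(\<integral>\<^sup>+z. indicator (pdiff p (c * a) (c * b) K) (\<lambda>i\<in>{..<p}. 0 + c *\<^sub>R z i) \<partial>?M)
      = (\<integral>\<^sup>+z. indicator (pdiff p a b K) z \<partial>?M)"
    using eq by (intro nn_integral_cong) (simp split: split_indicator)
  also have "\<dots> = emeasure ?M (pdiff p a b K)" by simp
  finally show ?thesis
    using assms(2) by (simp add: vol_power_def measure_def enn2real_mult ennreal_power)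
qed

lemma vol_power_pdiff_translation:
  fixes K :: "(real^'n) set"
  assumes "compact K"
  shows "vol_power p (pdiff p a b ((+) c ` K)) = vol_power p (pdiff p a b K)"
proof -
  let ?M = "lborel_power p :: (nat \<Rightarrow> real^'n) measure"
  have cpt: "compact ((+) c ` K)" using assms by (rule compact_translation)
  note [measurable] = sets_pdiff[OF assms(1)] sets_pdiff[OF cpt]
  have eq: "(\<lambda>i\<in>{..<p}. (a - b) *\<^sub>R c + 1 *\<^sub>R z i) \<in> pdiff p a b ((+) c ` K) \<longleftrightarrow> z \<in> pdiff p a b K"
    if "z \<in> space ?M" for z
  proof -
    have "(a - b) *\<^sub>R c + u + b *\<^sub>R (c + x) = a *\<^sub>R (c + y) \<longleftrightarrow> u + b *\<^sub>R x = a *\<^sub>R y" for u x y :: "real^'n"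
      by (simp add: algebra_simps)
    then show ?thesis using that by (simp add: pdiff_def hits_def space_lborel_power)
  qed
  have "emeasure ?M (pdiff p a b ((+) c ` K)) = (\<integral>\<^sup>+z. indicator (pdiff p a b ((+) c ` K)) z \<partial>?M)"
    by simp
  also have "\<dots> = (\<integral>\<^sup>+z. indicator (pdiff p a b ((+) c ` K)) (\<lambda>i\<in>{..<p}. (a - b) *\<^sub>R c + 1 *\<^sub>R z i) \<partial>?M)"
    by (subst nn_integral_PiM_lborel_affine[of 1, where t = "\<lambda>_. (a - b) *\<^sub>R c"]) simp_all
  also have "\<dots> = (\<integral>\<^sup>+z. indicator (pdiff p a b K) z \<partial>?M)"
    using eq by (intro nn_integral_cong) (simp split: split_indicator)
  also have "\<dots> = emeasure ?M (pdiff p a b K)" by simp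
  finally show ?thesis by (simp add: vol_power_def measure_def)
qed

section \<open>Fibration along the diagonal\<close>

lemma sigma_finite_lborel_power: "sigma_finite_measure (lborel_power p)"
proof -
  interpret finite_product_sigma_finite "\<lambda>i::nat. lborel :: (real^'n) measure" "{..<p}"
    by standard simp
  show "sigma_finite_measure (lborel_power p :: (nat \<Rightarrow> real^'n) measure)"
    by unfold_locales
qed

lemma pair_sigma_finite_lborel_power:
  "pair_sigma_finite (lborel_power p) (lborel :: 'a::euclidean_space measure)"
  by (simp add: pair_sigma_finite_def sigma_finite_lborel_power sigma_finite_lborel)

lemma hits_cong:
  assumes "\<And>i. i < p \<Longrightarrow> z i = z' i"
  shows "hits p a b K z \<longleftrightarrow> hits p a b K z'"
  using assms by (simp add: hits_def)

text \<open>\<open>w\<close> holds the differences of the first \<open>q\<close> coordinates to the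
  last one; the set collects the possible last coordinates of points of \<open>a K^p\<close>,
  \<open>p = q + 1\<close>, with these differences.\<close>

definition slice :: "nat \<Rightarrow> real \<Rightarrow> (real^'n) set \<Rightarrow> (nat \<Rightarrow> real^'n) \<Rightarrow> (real^'n) set" where
  "slice q a K w = {u \<in> (*\<^sub>R) a ` K. \<forall>i<q. w i + u \<in> (*\<^sub>R) a ` K}"

text \<open>Adding \<open>b x\<close> to all coordinates keeps their differences, so the condition
  says that \<open>y + b x\<close> lies in the slice for some \<open>x\<close> in \<open>K\<close>;
  solving for \<open>y\<close> produces the reflected body.\<close>

lemma hits_Suc_iff_mink:
  "hits (Suc q) a b K ((\<lambda>i. w i + y)(q := y)) \<longleftrightarrow> y \<in> mink (slice q a K w) b (uminus ` K)"
proof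
  assume "hits (Suc q) a b K ((\<lambda>i. w i + y)(q := y))"
  then obtain x where x: "x \<in> K" "\<And>i. i < Suc q \<Longrightarrow> \<exists>v\<in>K. ((\<lambda>i. w i + y)(q := y)) i + b *\<^sub>R x = a *\<^sub>R v"
    unfolding hits_def by blast
  have "y + b *\<^sub>R x \<in> (*\<^sub>R) a ` K" using x(2)[of q] by (simp add: image_iff)
  moreover have "w i + (y + b *\<^sub>R x) \<in> (*\<^sub>R) a ` K" if "i < q" for i
    using x(2)[of i] that by (simp add: image_iff add.assoc)
  ultimately have "y + b *\<^sub>R x \<in> slice q a K w" by (simp add: slice_def)
  then show "y \<in> mink (slice q a K w) b (uminus ` K)"
    unfolding mink_def using x(1)
    by (intro CollectI exI[of _ "y + b *\<^sub>R x"] exI[of _ "- x"]) simp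
next
  assume "y \<in> mink (slice q a K w) b (uminus ` K)"
  then obtain u x where ux: "u \<in> slice q a K w" "x \<in> K" "y + b *\<^sub>R x = u"
    unfolding mink_def by force
  have "\<exists>v\<in>K. ((\<lambda>i. w i + y)(q := y)) i + b *\<^sub>R x = a *\<^sub>R v" if "i < Suc q" for i
    using ux(1) that unfolding slice_def ux(3)[symmetric]
    by (cases "i = q") (simp_all add: image_iff add.assoc)
  then show "hits (Suc q) a b K ((\<lambda>i. w i + y)(q := y))"
    using ux(2) unfolding hits_def by blast
qed

lemma slice_eq_Int:
  "slice q a K w = (*\<^sub>R) a ` K \<inter> (\<Inter>i\<in>{..<q}. (+) (- w i) ` ((*\<^sub>R) a ` K))"
proof -
  have "v \<in> (+) (- c) ` S \<longleftrightarrow> c + v \<in> S" for v c :: "real^'n" and S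
    by (metis image_iff add_minus_cancel minus_add_cancel)
  then show ?thesis unfolding slice_def by blast
qed

lemma compact_slice:
  assumes "compact K"
  shows "compact (slice q a K w)"
proof -
  have c: "compact ((*\<^sub>R) a ` K)" by (rule compact_scaling[OF assms])
  have "closed (\<Inter>i\<in>{..<q}. (+) (- w i) ` ((*\<^sub>R) a ` K))"
    using c by (intro closed_INT ballI closed_translation compact_imp_closed)
  then show ?thesis unfolding slice_eq_Int by (rule compact_Int_closed[OF c])
qed

lemma convex_slice:
  assumes "convex K"
  shows "convex (slice q a K w)"
proof -
  have c: "convex ((*\<^sub>R) a ` K)" by (rule convex_scaling[OF assms])
  then show ?thesis unfolding slice_eq_Int by (intro convex_Int convex_INT convex_translation)
qed

text \<open>
  Modulo the diagonal translations, the fibres of \<open>pdiff\<close> are Minkowski sums in the base space.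
\<close>

lemma emeasure_pdiff_Suc:
  fixes K :: "(real^'n) set"
  assumes K: "compact K"
  shows "(\<lambda>w. emeasure lborel (mink (slice q a K w) b (uminus ` K))) \<in> borel_measurable (lborel_power q)"
    (is "?m \<in> _")
    and "emeasure (lborel_power (Suc q)) (pdiff (Suc q) a b K) =
    (\<integral>\<^sup>+w. emeasure lborel (mink (slice q a K w) b (uminus ` K)) \<partial>lborel_power q)"
proof -
  let ?M = "lborel_power q :: (nat \<Rightarrow> real^'n) measure"
  define f where "f = (\<lambda>z. if hits (Suc q) a b K z then 1 else 0 :: ennreal)"
  define g where "g = (\<lambda>w y. f ((\<lambda>i. w i + y)(q := y)))"
  interpret pair_sigma_finite ?M "lborel :: (real^'n) measure"
    by (rule pair_sigma_finite_lborel_power)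
  have [measurable]: "Measurable.pred (Pi\<^sub>M (insert q {..<q}) (\<lambda>_. lborel)) (\<lambda>z. hits (Suc q) a b K z)"
    by (rule measurable_hits[OF K]) (auto simp: less_Suc_eq)
  have fm [measurable]: "f \<in> borel_measurable (Pi\<^sub>M (insert q {..<q}) (\<lambda>_. lborel))"
    unfolding f_def by measurable
  have "(\<lambda>\<omega>. ((\<lambda>i. fst \<omega> i + snd \<omega>)(q := snd \<omega>)) i) \<in> borel_measurable (?M \<Otimes>\<^sub>M lborel)"
    if "i < Suc q" for i
    using that by (cases "i = q") auto
  then have [measurable]: "Measurable.pred (?M \<Otimes>\<^sub>M lborel) (\<lambda>\<omega>. hits (Suc q) a b K ((\<lambda>i. fst \<omega> i + snd \<omega>)(q := snd \<omega>)))"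
    by (intro measurable_hits[OF K]) auto
  have gm [measurable]: "case_prod g \<in> borel_measurable (?M \<Otimes>\<^sub>M lborel)"
    unfolding g_def f_def case_prod_beta by measurable
  have inner: "(\<integral>\<^sup>+y. g w y \<partial>lborel) = ?m w" for w
  proof -
    have "(\<lambda>y. g w y) = indicator (mink (slice q a K w) b (uminus ` K))"
      unfolding g_def f_def hits_Suc_iff_mink by (auto simp: fun_eq_iff)
    moreover have "compact (mink (slice q a K w) b (uminus ` K))"
      by (intro compact_mink compact_slice K compact_negations)
    ultimately show ?thesis by (simp add: borel_compact)
  qed
  have "(\<lambda>w. \<integral>\<^sup>+y. g w y \<partial>lborel) \<in> borel_measurable ?M"
    by measurable
  then show "?m \<in> borel_measurable ?M" by (simp add: inner)
  have ext: "{..<Suc q} = insert q {..<q}" by auto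
  have "pdiff (Suc q) a b K \<in> sets (lborel_power (Suc q))"
    by (rule sets_pdiff[OF K])
  then have "emeasure (lborel_power (Suc q)) (pdiff (Suc q) a b K) =
      (\<integral>\<^sup>+z. indicator (pdiff (Suc q) a b K) z \<partial>lborel_power (Suc q))"
    by simp
  also have "\<dots> = (\<integral>\<^sup>+z. f z \<partial>lborel_power (Suc q))"
    by (intro nn_integral_cong) (simp add: f_def pdiff_eq_space)
  also have "\<dots> = (\<integral>\<^sup>+y. (\<integral>\<^sup>+x. f (x(q := y)) \<partial>?M) \<partial>lborel)"
    unfolding ext by (rule lborel_product.product_nn_integral_insert_rev) auto
  also have "\<dots> = (\<integral>\<^sup>+y. (\<integral>\<^sup>+w. g w y \<partial>?M) \<partial>lborel)"
  proof (rule nn_integral_cong)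
    fix y :: "real^'n"
    have [measurable]: "(\<lambda>x. f (x(q := y))) \<in> borel_measurable ?M"
      by (rule measurable_compose[OF _ fm]) measurable
    \<comment> \<open>With the last coordinate \<open>y\<close> fixed, shifting the others by
      \<open>y\<close> preserves measure and makes the differences the variables of
      integration.\<close>
    have "(\<integral>\<^sup>+x. f (x(q := y)) \<partial>?M) = (\<integral>\<^sup>+w. f ((\<lambda>i\<in>{..<q}. y + 1 *\<^sub>R w i)(q := y)) \<partial>?M)"
      by (subst nn_integral_PiM_lborel_affine[of 1, where t = "\<lambda>_. y"]) simp_all
    also have "\<dots> = (\<integral>\<^sup>+w. g w y \<partial>?M)"
    proof (rule nn_integral_cong)
      fix w
      have "hits (Suc q) a b K ((\<lambda>i\<in>{..<q}. y + 1 *\<^sub>R w i)(q := y))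
          = hits (Suc q) a b K ((\<lambda>i. w i + y)(q := y))"
        by (rule hits_cong) (auto simp: add.commute less_Suc_eq)
      then show "f ((\<lambda>i\<in>{..<q}. y + 1 *\<^sub>R w i)(q := y)) = g w y"
        by (simp only: f_def g_def)
    qed
    finally show "(\<integral>\<^sup>+x. f (x(q := y)) \<partial>?M) = (\<integral>\<^sup>+w. g w y \<partial>?M)" .
  qed
  also have "\<dots> = (\<integral>\<^sup>+w. (\<integral>\<^sup>+y. g w y \<partial>lborel) \<partial>?M)"
    by (rule Fubini') measurable
  finally show "emeasure (lborel_power (Suc q)) (pdiff (Suc q) a b K) = (\<integral>\<^sup>+w. ?m w \<partial>?M)"
    by (simp add: inner)
qed

lemma interpolated_lebesgue_integral:
  assumes "\<And>x. interpolated n (\<lambda>b. e b x)" "\<And>b. b > 0 \<Longrightarrow> has_bochner_integral M (e b) (h b)"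
  shows "interpolated n h"
  unfolding interpolated_def
proof (intro allI impI)
  fix b :: real assume b: "b > 0"
  have "has_bochner_integral M (\<lambda>x. \<Sum>k\<le>n. e (real k + 1) x * poly (lagrange_basis n k) b)
      (\<Sum>k\<le>n. h (real k + 1) * poly (lagrange_basis n k) b)"
    by (intro has_bochner_integral_sum has_bochner_integral_mult_left assms(2)) auto
  moreover have "(\<lambda>x. \<Sum>k\<le>n. e (real k + 1) x * poly (lagrange_basis n k) b) = e b"
    using assms(1) b by (auto simp: interpolated_def)
  ultimately show "h b = (\<Sum>k\<le>n. h (real k + 1) * poly (lagrange_basis n k) b)"
    using assms(2)[OF b] has_bochner_integral_eq by metis
qed

lemma interior_uminus_nonempty:
  fixes K :: "'a::euclidean_space set"
  assumes "interior K \<noteq> {}"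
  shows "interior (uminus ` K) \<noteq> {}"
  using assms by (simp add: interior_negations)

text \<open>The slice over \<open>w\<close> does not depend on \<open>b\<close>, so each fibre
  volume has degree at most \<open>CARD('n)\<close> in \<open>b\<close>, and integration over
  \<open>w\<close> keeps the degree. Slices may be flat; the interior point required for Minkowski
  sums comes from \<open>-K\<close>.\<close>

proposition interpolated_vol_power_pdiff:
  fixes K :: "(real^'n) set"
  assumes K: "compact K" "convex K" "interior K \<noteq> {}"
  shows "interpolated CARD('n) (\<lambda>b. vol_power (Suc q) (pdiff (Suc q) 1 b K))"
proof (rule interpolated_lebesgue_integral)
  fix w :: "nat \<Rightarrow> real^'n"
  show "interpolated CARD('n) (\<lambda>b. measure lborel (mink (slice q 1 K w) b (uminus ` K)))"
  proof (cases "slice q 1 K w = {}")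
    case True
    then show ?thesis by (simp add: mink_def interpolated_def)
  next
    case False
    then show ?thesis
      using K by (intro interpolated_mink compact_slice convex_slice compact_negations
          convex_negations interior_uminus_nonempty)
  qed
next
  fix b :: real
  let ?m = "\<lambda>w. mink (slice q 1 K w) b (uminus ` K)"
  let ?I = "emeasure (lborel_power (Suc q)) (pdiff (Suc q) 1 b K)"
  have fin: "emeasure lborel (?m w) \<noteq> \<infinity>" for w
  proof -
    have "compact (?m w)" using K by (intro compact_mink compact_slice compact_negations)
    then show ?thesis using emeasure_bounded_finite[OF compact_imp_bounded] by force
  qed
  have "has_bochner_integral (lborel_power q) (\<lambda>w. measure lborel (?m w)) (enn2real ?I)"
  proof (rule has_bochner_integral_nn_integral)
    show "(\<lambda>w. measure lborel (?m w)) \<in> borel_measurable (lborel_power q)"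
      unfolding measure_def using emeasure_pdiff_Suc(1)[OF K(1)] by measurable
    have "(\<integral>\<^sup>+w. ennreal (measure lborel (?m w)) \<partial>lborel_power q) = ?I"
      unfolding emeasure_pdiff_Suc(2)[OF K(1)] using fin
      by (intro nn_integral_cong) (simp add: emeasure_eq_ennreal_measure)
    then show "(\<integral>\<^sup>+w. ennreal (measure lborel (?m w)) \<partial>lborel_power q) = ennreal (enn2real ?I)"
      using emeasure_pdiff_finite[OF K(1), of "Suc q" 1 b] by simp
  qed auto
  then show "has_bochner_integral (lborel_power q) (\<lambda>w. measure lborel (?m w))
      (vol_power (Suc q) (pdiff (Suc q) 1 b K))"
    by (simp add: vol_power_def measure_def)
qed

section \<open>The integral inequality\<close>

lemma emeasure_lborel_affine_image:
  fixes K :: "(real^'n) set"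
  assumes "compact K" "c \<ge> 0"
  shows "emeasure lborel ((\<lambda>x. s + c *\<^sub>R x) ` K) = ennreal (c ^ CARD('n)) * emeasure lborel K"
proof -
  have "compact ((\<lambda>x. s + c *\<^sub>R x) ` K)"
    using assms by (intro compact_continuous_image continuous_intros)
  moreover have "emeasure lebesgue ((\<lambda>x. s + c *\<^sub>R x) ` K) = ennreal (c ^ CARD('n)) * emeasure lebesgue K"
    using assms(2) emeasure_lebesgue_affine[of c s K] by (simp add: add.commute)
  ultimately show ?thesis using assms(1) by (simp add: borel_compact)
qed

text \<open>Let \<open>x\<close> and \<open>y\<close> witness the hit in coordinate
  \<open>i\<close>. For \<open>v\<close> in \<open>K\<close> the point
  \<open>t (u x + (1 - u) v)\<close> lies in \<open>t K\<close>, and adding \<open>z i\<close> turns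
  it into \<open>(1 - t + t u) y + t (1 - u) v\<close>, which is in \<open>K\<close> because these
  coefficients add up to \<open>1\<close>.\<close>

lemma emeasure_slice_ge:
  fixes K :: "(real^'n) set"
  assumes K: "compact K" "convex K" and t: "0 < t" "t \<le> 1" and u: "0 \<le> u" "u \<le> 1"
    and hits: "hits p (1 - t + t * u) (t * u) K z"
  shows "ennreal ((t * (1 - u)) ^ CARD('n)) * emeasure lborel K
    \<le> emeasure lborel {x \<in> (*\<^sub>R) t ` K. \<forall>i<p. z i + x \<in> K}"
proof -
  from hits obtain x where x: "x \<in> K" "\<And>i. i < p \<Longrightarrow> \<exists>y\<in>K. z i + (t * u) *\<^sub>R x = (1 - t + t * u) *\<^sub>R y"
    by (auto simp: hits_def)
  let ?T = "{x \<in> (*\<^sub>R) t ` K. \<forall>i<p. z i + x \<in> K}"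
  have "(\<lambda>v. (t * u) *\<^sub>R x + (t * (1 - u)) *\<^sub>R v) ` K \<subseteq> ?T"
  proof (rule image_subsetI)
    fix v assume v: "v \<in> K"
    have "u *\<^sub>R x + (1 - u) *\<^sub>R v \<in> K"
      using K(2) x(1) v u by (intro convexD) auto
    moreover have "(t * u) *\<^sub>R x + (t * (1 - u)) *\<^sub>R v = t *\<^sub>R (u *\<^sub>R x + (1 - u) *\<^sub>R v)"
      by (simp add: scaleR_add_right)
    ultimately have 1: "(t * u) *\<^sub>R x + (t * (1 - u)) *\<^sub>R v \<in> (*\<^sub>R) t ` K" by (metis imageI)
    have "z i + ((t * u) *\<^sub>R x + (t * (1 - u)) *\<^sub>R v) \<in> K" if "i < p" for i
    proof -
      from x(2)[OF that] obtain y where y: "y \<in> K" "z i + (t * u) *\<^sub>R x = (1 - t + t * u) *\<^sub>R y" by blast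
      have "t * u \<ge> 0" "t * (1 - u) \<ge> 0" using t u by auto
      then have "(1 - t + t * u) *\<^sub>R y + (t * (1 - u)) *\<^sub>R v \<in> K"
        using K(2) y(1) v t by (intro convexD) (auto simp: algebra_simps)
      then show ?thesis by (simp add: y(2)[symmetric] add.assoc)
    qed
    with 1 show "(t * u) *\<^sub>R x + (t * (1 - u)) *\<^sub>R v \<in> ?T" by simp
  qed
  moreover have "?T \<in> sets lborel"
  proof -
    have "compact ((*\<^sub>R) t ` K)" by (rule compact_scaling[OF K(1)])
    then have [measurable]: "(*\<^sub>R) t ` K \<in> sets borel" "K \<in> sets borel"
      using K(1) by (auto intro: borel_compact)
    show ?thesis by measurable
  qed
  ultimately have "emeasure lborel ((\<lambda>v. (t * u) *\<^sub>R x + (t * (1 - u)) *\<^sub>R v) ` K) \<le> emeasure lborel ?T"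
    by (rule emeasure_mono)
  then show ?thesis
    using emeasure_lborel_affine_image[OF K(1), of "t * (1 - u)" "(t * u) *\<^sub>R x"] t u by simp
qed

text \<open>The weight is the density on \<open>[0, 1]\<close> that gives \<open>[1 - s, 1]\<close>
  the mass \<open>s ^ n\<close>. The premise confines \<open>P\<close> to such an interval, with
  \<open>s\<close> the \<open>n\<close>-th root of \<open>m\<close> capped at
  \<open>1\<close>.\<close>

lemma nn_integral_weight_superlevel:
  fixes m :: real
  assumes "n > 0" "m \<ge> 0" and P: "\<And>u. 0 \<le> u \<Longrightarrow> u \<le> 1 \<Longrightarrow> P u \<Longrightarrow> (1 - u) ^ n \<le> m"
  shows "(\<integral>\<^sup>+u. ennreal (indicator {0..1} u * (real n * (1 - u) ^ (n - 1))) * of_bool (P u) \<partial>lborel) \<le> ennreal m"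
proof -
  define s where "s = min 1 (root n m)"
  have s: "0 \<le> s" "s \<le> 1" using assms by (auto simp: s_def)
  have "u \<ge> 1 - s" if "0 \<le> u" "u \<le> 1" "P u" for u
  proof -
    have "root n ((1 - u) ^ n) \<le> root n m" using P[OF that] assms(1) by simp
    then have "1 - u \<le> root n m" using assms(1) that by (simp add: real_root_power_cancel)
    then show ?thesis using that by (simp add: s_def)
  qed
  then have "(\<integral>\<^sup>+u. ennreal (indicator {0..1} u * (real n * (1 - u) ^ (n - 1))) * of_bool (P u) \<partial>lborel)
      \<le> (\<integral>\<^sup>+u. ennreal (real n * (1 - u) ^ (n - 1)) * indicator {1 - s..1} u \<partial>lborel)"
    by (intro nn_integral_mono) (auto simp: indicator_def of_bool_def)
  also have "\<dots> = ennreal ((- ((1 - 1) ^ n)) - (- ((1 - (1 - s)) ^ n)))"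
  proof (rule nn_integral_FTC_Icc)
    show "DERIV (\<lambda>u. - ((1 - u) ^ n)) u :> real n * (1 - u) ^ (n - 1)" for u :: real
      by (auto intro!: derivative_eq_intros)
  qed (use s in auto)
  also have "\<dots> = ennreal (s ^ n)" using assms(1) by (simp add: zero_power)
  also have "\<dots> \<le> ennreal m"
  proof (rule ennreal_leI)
    have "s ^ n \<le> root n m ^ n" using s by (intro power_mono) (auto simp: s_def)
    then show "s ^ n \<le> m" using assms by simp
  qed
  finally show ?thesis .
qed

text \<open>
  Evaluate the measure of \<open>{(z, x). x \<in> t K, z\<^sub>i + x \<in> K}\<close> in both orders: every fibre over \<open>z\<close>
  contains a translate of \<open>t (1 - u) K\<close> whenever \<open>z \<in> (1 - t + t u) K\<^sup>p - t u \<Delta>\<^sub>p K\<close>.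
\<close>

proposition nn_integral_weighted_pdiff_le:
  fixes K :: "(real^'n) set"
  assumes K: "compact K" "convex K" and pos: "measure lborel K > 0" and t: "0 < t" "t \<le> 1"
  shows "(\<integral>\<^sup>+u. ennreal (indicator {0..1} u * (real CARD('n) * (1 - u) ^ (CARD('n) - 1)))
      * emeasure (lborel_power p) (pdiff p (1 - t + t * u) (t * u) K) \<partial>lborel)
    \<le> ennreal (measure lborel K ^ p)"
proof -
  let ?M = "lborel_power p :: (nat \<Rightarrow> real^'n) measure"
  define n where "n = CARD('n)"
  define V where "V = measure lborel K"
  have V: "emeasure lborel K = ennreal V" "V > 0"
    using emeasure_bounded_finite[OF compact_imp_bounded[OF K(1)]] pos
    by (auto simp: V_def emeasure_eq_ennreal_measure)
  have [measurable]: "K \<in> sets borel" using K(1) by (rule borel_compact)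
  have ctK: "compact ((*\<^sub>R) t ` K)" by (rule compact_scaling[OF K(1)])
  then have [measurable]: "(*\<^sub>R) t ` K \<in> sets borel" by (rule borel_compact)
  have VtK: "emeasure lborel ((*\<^sub>R) t ` K) = ennreal (t ^ n * V)"
    using emeasure_lborel_affine_image[OF K(1), of t 0] t V by (simp add: n_def ennreal_mult)
  define c where "c = (\<lambda>u::real. ennreal (indicator {0..1} u * (real n * (1 - u) ^ (n - 1))))"
  have [measurable]: "c \<in> borel_measurable borel" unfolding c_def by measurable
  define H where "H = (\<lambda>z u. hits p (1 - t + t * u) (t * u) K z)"
  define T where "T = (\<lambda>z x. x \<in> (*\<^sub>R) t ` K \<and> (\<forall>i\<in>{..<p}. z i + x \<in> K))"
  interpret P1: pair_sigma_finite ?M "lborel :: real measure"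
    by (rule pair_sigma_finite_lborel_power)
  interpret P2: pair_sigma_finite ?M "lborel :: (real^'n) measure"
    by (rule pair_sigma_finite_lborel_power)
  have [measurable]: "Measurable.pred (?M \<Otimes>\<^sub>M lborel) (\<lambda>\<omega>. H (fst \<omega>) (snd \<omega>))"
    unfolding H_def by (intro measurable_hits[OF K(1)]) measurable
  have [measurable]: "Measurable.pred (?M \<Otimes>\<^sub>M lborel) (\<lambda>\<omega>. T (fst \<omega>) (snd \<omega>))"
    unfolding T_def by measurable
  have pd: "emeasure ?M (pdiff p (1 - t + t * u) (t * u) K) = (\<integral>\<^sup>+z. of_bool (H z u) \<partial>?M)" for u
  proof -
    have "emeasure ?M (pdiff p (1 - t + t * u) (t * u) K)
        = (\<integral>\<^sup>+z. indicator (pdiff p (1 - t + t * u) (t * u) K) z \<partial>?M)"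
      using sets_pdiff[OF K(1)] by simp
    also have "\<dots> = (\<integral>\<^sup>+z. of_bool (H z u) \<partial>?M)"
      by (intro nn_integral_cong) (simp add: H_def pdiff_eq_space)
    finally show ?thesis .
  qed
  have pointwise: "ennreal (t ^ n * V) * (\<integral>\<^sup>+u. c u * of_bool (H z u) \<partial>lborel)
      \<le> (\<integral>\<^sup>+x. of_bool (T z x) \<partial>lborel)" for z
  proof -
    define A where "A = {x \<in> (*\<^sub>R) t ` K. \<forall>i<p. z i + x \<in> K}"
    have A: "A \<in> sets borel" unfolding A_def by measurable
    have "emeasure lborel A \<le> emeasure lborel ((*\<^sub>R) t ` K)"
      by (intro emeasure_mono) (auto simp: A_def)
    then have fin: "emeasure lborel A \<noteq> \<infinity>" unfolding VtK by (auto simp: top_unique)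
    \<comment> \<open>The fraction of \<open>t K\<close> filled by the fibre; in this normalisation
      \<open>t\<close> drops out of the lower bound \<open>(t * (1 - u)) ^ n * V\<close>.\<close>
    define m where "m = measure lborel A / (t ^ n * V)"
    have tnV: "t ^ n * V > 0" using t V by simp
    have "(\<integral>\<^sup>+u. c u * of_bool (H z u) \<partial>lborel) \<le> ennreal m"
      unfolding c_def
    proof (rule nn_integral_weight_superlevel)
      show "n > 0" "m \<ge> 0" using tnV by (auto simp: n_def m_def)
      fix u :: real assume u: "0 \<le> u" "u \<le> 1" "H z u"
      have "ennreal ((t * (1 - u)) ^ n * V) \<le> ennreal (measure lborel A)"
        using emeasure_slice_ge[OF K t u(1,2) u(3)[unfolded H_def]] fin t u V
        by (simp add: n_def A_def[symmetric] emeasure_eq_ennreal_measure ennreal_mult)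
      then show "(1 - u) ^ n \<le> m"
        using tnV unfolding power_mult_distrib by (simp add: m_def field_simps)
    qed
    then have "ennreal (t ^ n * V) * (\<integral>\<^sup>+u. c u * of_bool (H z u) \<partial>lborel) \<le> ennreal (t ^ n * V) * ennreal m"
      by (rule mult_left_mono) simp
    also have "\<dots> = ennreal (measure lborel A)"
      using tnV V t by (simp add: m_def flip: ennreal_mult)
    also have "\<dots> = (\<integral>\<^sup>+x. indicator A x \<partial>lborel)"
      using A fin by (simp add: emeasure_eq_ennreal_measure)
    also have "\<dots> = (\<integral>\<^sup>+x. of_bool (T z x) \<partial>lborel)"
      by (intro nn_integral_cong) (auto simp: T_def A_def indicator_def)
    finally show ?thesis .
  qed
  \<comment> \<open>For fixed \<open>x\<close> in \<open>t K\<close> the conditions on the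
    coordinates are independent: each \<open>z i\<close> ranges over a translate of
    \<open>K\<close>.\<close>
  have fibre: "(\<integral>\<^sup>+z. of_bool (T z x) \<partial>?M) = indicator ((*\<^sub>R) t ` K) x * ennreal (V ^ p)" for x
  proof (cases "x \<in> (*\<^sub>R) t ` K")
    case True
    let ?K = "(\<lambda>v. - x + 1 *\<^sub>R v) ` K"
    have cK: "?K \<in> sets borel"
      using K(1) by (intro borel_compact compact_continuous_image continuous_intros)
    have "z \<in> (\<Pi>\<^sub>E i\<in>{..<p}. ?K) \<longleftrightarrow> T z x" if "z \<in> space ?M" for z
    proof -
      have "v \<in> ?K \<longleftrightarrow> v + x \<in> K" for v by (force simp: image_iff)
      then show ?thesis using that True by (auto simp: T_def PiE_iff space_lborel_power)
    qed
    then have "(\<integral>\<^sup>+z. of_bool (T z x) \<partial>?M) = (\<integral>\<^sup>+z. indicator (\<Pi>\<^sub>E i\<in>{..<p}. ?K) z \<partial>?M)"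
      by (intro nn_integral_cong) (simp add: indicator_def)
    also have "\<dots> = emeasure ?M (\<Pi>\<^sub>E i\<in>{..<p}. ?K)"
      using cK by (intro nn_integral_indicator sets_PiM_I_finite) auto
    also have "\<dots> = (\<Prod>i\<in>{..<p}. emeasure lborel ?K)"
      using cK by (intro lborel_product.emeasure_PiM) auto
    also have "\<dots> = ennreal (V ^ p)"
      using V unfolding emeasure_lborel_affine_image[OF K(1) zero_le_one] by (simp add: ennreal_power)
    finally show ?thesis using True by simp
  next
    case False
    then show ?thesis by (simp add: T_def)
  qed
  let ?L = "\<integral>\<^sup>+u. c u * emeasure ?M (pdiff p (1 - t + t * u) (t * u) K) \<partial>lborel"
  have "?L = (\<integral>\<^sup>+u. (\<integral>\<^sup>+z. c u * of_bool (H z u) \<partial>?M) \<partial>lborel)"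
  proof -
    have "Measurable.pred ?M (\<lambda>z. H z u)" for u
      unfolding H_def by (intro measurable_hits[OF K(1)]) measurable
    then have "(\<lambda>z. of_bool (H z u) :: ennreal) \<in> borel_measurable ?M" for u
      by (rule measurable_compose) simp
    from nn_integral_cmult[OF this] show ?thesis unfolding pd by simp
  qed
  also have "\<dots> = (\<integral>\<^sup>+z. (\<integral>\<^sup>+u. c u * of_bool (H z u) \<partial>lborel) \<partial>?M)"
    by (rule P1.Fubini') measurable
  finally have "ennreal (t ^ n * V) * ?L
      = (\<integral>\<^sup>+z. ennreal (t ^ n * V) * (\<integral>\<^sup>+u. c u * of_bool (H z u) \<partial>lborel) \<partial>?M)"
    by (simp add: nn_integral_cmult)
  also have "\<dots> \<le> (\<integral>\<^sup>+z. (\<integral>\<^sup>+x. of_bool (T z x) \<partial>lborel) \<partial>?M)"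
    by (intro nn_integral_mono pointwise)
  also have "\<dots> = (\<integral>\<^sup>+x. (\<integral>\<^sup>+z. of_bool (T z x) \<partial>?M) \<partial>lborel)"
    by (rule P2.Fubini'[symmetric]) measurable
  also have "\<dots> = ennreal (t ^ n * V) * ennreal (V ^ p)"
    unfolding fibre by (simp add: nn_integral_multc VtK)
  finally have "ennreal (t ^ n * V) * ?L \<le> ennreal (t ^ n * V) * ennreal (V ^ p)" .
  then show ?thesis
    using t V by (subst (asm) ennreal_mult_le_mult_iff) (auto simp: c_def n_def V_def)
qed

section \<open>Polynomiality and mixed volumes\<close>

lemma vol_power_nonneg: "vol_power p A \<ge> 0"
  by (simp add: vol_power_def)

lemma vol_power_pdiff_mono:
  assumes "compact K" "compact K'" "pdiff p a b K \<subseteq> pdiff p a' b' K'"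
  shows "vol_power p (pdiff p a b K) \<le> vol_power p (pdiff p a' b' K')"
  unfolding vol_power_def
  using assms emeasure_pdiff_finite[OF assms(2)]
  by (intro measure_mono_fmeasurable sets_pdiff fmeasurableI) auto

lemma pdiff_one_zero:
  assumes "K \<noteq> {}"
  shows "pdiff p 1 0 K = (\<Pi>\<^sub>E i\<in>{..<p}. K)"
proof -
  obtain x where "x \<in> K" using assms by blast
  then have "hits p 1 0 K z \<longleftrightarrow> (\<forall>i<p. z i \<in> K)" for z
    unfolding hits_def by simp blast
  then show ?thesis unfolding pdiff_def PiE_def Pi_def by blast
qed

lemma vol_power_pdiff_one_zero:
  fixes K :: "(real^'n) set"
  assumes "compact K" "K \<noteq> {}"
  shows "vol_power p (pdiff p 1 0 K) = measure lborel K ^ p"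
proof -
  have "emeasure lborel K = ennreal (measure lborel K)"
    using emeasure_bounded_finite[OF compact_imp_bounded[OF assms(1)]]
    by (simp add: emeasure_eq_ennreal_measure)
  then have "emeasure (lborel_power p) (\<Pi>\<^sub>E i\<in>{..<p}. K) = ennreal (measure lborel K ^ p)"
    using assms(1) by (subst lborel_product.emeasure_PiM) (auto simp: borel_compact ennreal_power)
  then show ?thesis
    by (simp add: vol_power_def pdiff_one_zero[OF assms(2)] measure_def)
qed

section \<open>Bounds near the edges of the quadrant\<close>

lemma convex_scaled_sum:
  assumes "convex K" "x \<in> K" "y \<in> K" "a \<ge> 0" "b \<ge> 0"
  shows "\<exists>z\<in>K. a *\<^sub>R x + b *\<^sub>R y = (a + b) *\<^sub>R z"
proof (cases "a + b = 0")
  case True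
  then have "a = 0" "b = 0" using assms by auto
  then show ?thesis using assms by auto
next
  case False
  then have "(a / (a + b)) *\<^sub>R x + (b / (a + b)) *\<^sub>R y \<in> K"
    using assms by (intro convexD) (auto simp: add_divide_distrib[symmetric])
  moreover have "a *\<^sub>R x + b *\<^sub>R y = (a + b) *\<^sub>R ((a / (a + b)) *\<^sub>R x + (b / (a + b)) *\<^sub>R y)"
    using False by (simp add: scaleR_add_right)
  ultimately show ?thesis by blast
qed

text \<open>\<open>C = R / r\<close> for a ball of radius \<open>r\<close> inside \<open>K\<close>
  and one of radius \<open>R\<close> around it. A reflected copy of \<open>K\<close> can then be
  absorbed into a multiple of \<open>K\<close>, which bounds volumes from above as one coefficient
  tends to \<open>0\<close>.\<close>

lemma reflection_constant:
  fixes K :: "'a::euclidean_space set"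
  assumes "compact K" "0 \<in> interior K"
  obtains C where "C > 0" "\<And>x. x \<in> K \<Longrightarrow> \<exists>y\<in>K. - x = C *\<^sub>R y"
proof -
  obtain r where r: "r > 0" "cball 0 r \<subseteq> K" using assms(2) by (auto simp: mem_interior_cball)
  obtain R where R: "R > 0" "\<And>x. x \<in> K \<Longrightarrow> norm x \<le> R"
    using compact_imp_bounded[OF assms(1)] by (auto simp: bounded_pos)
  show thesis
  proof (rule that[of "R / r"])
    show "R / r > 0" using r R by simp
    fix x assume "x \<in> K"
    then have "norm ((r / R) *\<^sub>R (- x)) \<le> r" using R(2)[of x] R(1) r by (simp add: field_simps)
    then have "(r / R) *\<^sub>R (- x) \<in> K" using r by auto
    then show "\<exists>y\<in>K. - x = (R / r) *\<^sub>R y" using r R by (intro bexI) auto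
  qed
qed

lemma pdiff_body_vertex_mono:
  assumes "0 \<in> K"
  shows "pdiff p 0 b K \<subseteq> pdiff p a b K"
proof
  fix z assume "z \<in> pdiff p 0 b K"
  then obtain x where z: "z \<in> extensional {..<p}" and x: "x \<in> K" "\<And>i. i < p \<Longrightarrow> z i + b *\<^sub>R x = a *\<^sub>R 0"
    unfolding pdiff_def hits_def by auto
  then have "hits p a b K z" unfolding hits_def using assms by blast
  then show "z \<in> pdiff p a b K" using z by (simp add: pdiff_def)
qed

lemma pdiff_diag_vertex_mono:
  assumes "0 \<in> K"
  shows "pdiff p a 0 K \<subseteq> pdiff p a b K"
proof
  fix z assume "z \<in> pdiff p a 0 K"
  then have z: "z \<in> extensional {..<p}" and "\<And>i. i < p \<Longrightarrow> \<exists>y\<in>K. z i + b *\<^sub>R 0 = a *\<^sub>R y"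
    unfolding pdiff_def hits_def by auto
  then have "hits p a b K z" unfolding hits_def using assms by blast
  then show "z \<in> pdiff p a b K" using z by (simp add: pdiff_def)
qed

text \<open>Since \<open>-K\<close> is absorbed by \<open>C K\<close>, the body fits into
  \<open>(1 + C b) K^p\<close>; the bound tends to the value at \<open>b = 0\<close>.\<close>

lemma vol_power_pdiff_le_body:
  fixes K :: "(real^'n) set"
  assumes K: "compact K" "convex K"
    and C: "C > 0" "\<And>x. x \<in> K \<Longrightarrow> \<exists>y\<in>K. - x = C *\<^sub>R y" and b: "b \<ge> 0"
  shows "vol_power p (pdiff p 1 b K) \<le> (1 + C * b) ^ (CARD('n) * p) * vol_power p (pdiff p 1 0 K)"
proof -
  have "pdiff p 1 b K \<subseteq> pdiff p (1 + C * b) 0 K"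
  proof
    fix z assume "z \<in> pdiff p 1 b K"
    then obtain x where z: "z \<in> extensional {..<p}"
      and x: "x \<in> K" "\<And>i. i < p \<Longrightarrow> \<exists>y\<in>K. z i + b *\<^sub>R x = 1 *\<^sub>R y"
      unfolding pdiff_def hits_def by blast
    obtain x' where x': "x' \<in> K" "- x = C *\<^sub>R x'" using C(2)[OF x(1)] by blast
    have "\<exists>y\<in>K. z i + 0 *\<^sub>R x = (1 + C * b) *\<^sub>R y" if "i < p" for i
    proof -
      from x(2)[OF that] obtain y where y: "y \<in> K" "z i + b *\<^sub>R x = 1 *\<^sub>R y" by blast
      have "z i = y + b *\<^sub>R (- x)" using y(2) by (simp add: algebra_simps)
      then have "z i = 1 *\<^sub>R y + (C * b) *\<^sub>R x'" by (simp add: x'(2) mult.commute)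
      moreover have "\<exists>v\<in>K. 1 *\<^sub>R y + (C * b) *\<^sub>R x' = (1 + C * b) *\<^sub>R v"
        using C(1) b by (intro convex_scaled_sum K y x') auto
      ultimately show ?thesis by simp
    qed
    then show "z \<in> pdiff p (1 + C * b) 0 K" using z x(1) unfolding pdiff_def hits_def by blast
  qed
  then have "vol_power p (pdiff p 1 b K) \<le> vol_power p (pdiff p (1 + C * b) 0 K)"
    by (rule vol_power_pdiff_mono[OF K(1) K(1)])
  also have "\<dots> = (1 + C * b) ^ (CARD('n) * p) * vol_power p (pdiff p 1 0 K)"
    using vol_power_pdiff_scale[OF K(1), of "1 + C * b" p 1 0] C b by (simp add: add_pos_nonneg)
  finally show ?thesis .
qed

text \<open>For a single copy the diagonal is all of R^n, so \<open>a K\<close> can be absorbed into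
  a multiple of \<open>-K\<close>. For more copies the limit at \<open>a = 0\<close> is
  \<open>0\<close> and calls for no such bound.\<close>

lemma vol_power_pdiff_le_diag:
  fixes K :: "(real^'n) set"
  assumes K: "compact K" "convex K"
    and C: "C > 0" "\<And>x. x \<in> K \<Longrightarrow> \<exists>y\<in>K. - x = C *\<^sub>R y" and ab: "a \<ge> 0" "b > 0"
  shows "vol_power 1 (pdiff 1 a b K) \<le> (b + C * a) ^ CARD('n) * vol_power 1 (pdiff 1 0 1 K)"
proof -
  have "pdiff 1 a b K \<subseteq> pdiff 1 0 (b + C * a) K"
  proof
    fix z assume "z \<in> pdiff 1 a b K"
    then obtain x y where z: "z \<in> extensional {..<1}" and xy: "x \<in> K" "y \<in> K" "z 0 + b *\<^sub>R x = a *\<^sub>R y"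
      unfolding pdiff_def hits_def by blast
    obtain y' where y': "y' \<in> K" "- y = C *\<^sub>R y'" using C(2)[OF xy(2)] by blast
    obtain v where v: "v \<in> K" "b *\<^sub>R x + (C * a) *\<^sub>R y' = (b + C * a) *\<^sub>R v"
      using convex_scaled_sum[OF K(2) xy(1) y'(1), of b "C * a"] C ab by auto
    have "a *\<^sub>R (- y) = (C * a) *\<^sub>R y'" by (simp add: y'(2) mult.commute)
    then have "z 0 + (b *\<^sub>R x + (C * a) *\<^sub>R y') = 0"
      using xy(3) by (simp add: add_diff_eq flip: \<open>a *\<^sub>R (- y) = (C * a) *\<^sub>R y'\<close>)
    then have "\<forall>i<1. \<exists>y\<in>K. z i + (b + C * a) *\<^sub>R v = 0 *\<^sub>R y"
      using v xy(1) by auto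
    then show "z \<in> pdiff 1 0 (b + C * a) K" using z v(1) unfolding pdiff_def hits_def by blast
  qed
  then have "vol_power 1 (pdiff 1 a b K) \<le> vol_power 1 (pdiff 1 0 (b + C * a) K)"
    by (rule vol_power_pdiff_mono[OF K(1) K(1)])
  also have "\<dots> = (b + C * a) ^ CARD('n) * vol_power 1 (pdiff 1 0 1 K)"
    using vol_power_pdiff_scale[OF K(1), of "b + C * a" 1 0 1] C ab by (simp add: add_pos_nonneg)
  finally show ?thesis .
qed

text \<open>The closed quadrant matters: mixed volumes are one-sided derivatives at the origin,
  where the other arguments vanish. For \<open>p \<ge> 1\<close> the truncated subtraction in the
  exponent of \<open>a\<close> is exact.\<close>

definition pdiff_polynomial :: "nat \<Rightarrow> (real^'n) set \<Rightarrow> (nat \<Rightarrow> real) \<Rightarrow> bool" where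
  "pdiff_polynomial p K \<alpha> \<longleftrightarrow> (\<forall>a\<ge>0. \<forall>b\<ge>0. vol_power p (pdiff p a b K) =
     (\<Sum>i\<le>CARD('n). \<alpha> i * a ^ (CARD('n) * p - i) * b ^ i))"

lemma isCont_le_at_right:
  fixes f g :: "real \<Rightarrow> real"
  assumes "isCont f 0" "isCont g 0" "\<And>x. x > 0 \<Longrightarrow> f x \<le> g x"
  shows "f 0 \<le> g 0"
proof (rule tendsto_le[OF trivial_limit_at_right_real])
  show "(g \<longlongrightarrow> g 0) (at_right 0)" "(f \<longlongrightarrow> f 0) (at_right 0)"
    using assms(1,2) by (auto simp: isCont_def intro: tendsto_within_subset)
  show "\<forall>\<^sub>F x in at_right 0. f x \<le> g x"
    using assms(3) eventually_at_right_less[of "0::real"] by (auto elim: eventually_mono)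
qed

text \<open>On the open quadrant homogeneity reduces to \<open>a = 1\<close>, where interpolation
  supplies the coefficients. The edges follow by sandwiching: as the origin is in \<open>K\<close>,
  the edge bodies are contained in the nearby ones, and the absorption bounds give the reverse
  inequality in the limit.\<close>

lemma pdiff_polynomial_of_zero_interior:
  fixes K :: "(real^'n) set"
  assumes K: "compact K" "convex K" "0 \<in> interior K" and p: "p = Suc q"
  shows "\<exists>\<alpha>. pdiff_polynomial p K \<alpha>"
proof -
  define n where "n = CARD('n)"
  define N where "N = n * p"
  define v where "v = (\<lambda>a b. vol_power p (pdiff p a b K))"
  have n: "n > 0" "n \<le> N" by (auto simp: n_def N_def p)
  have K0: "0 \<in> K" using K(3) interior_subset by auto
  have scale: "v (c * a) (c * b) = c ^ N * v a b" if "c > 0" for a b c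
    unfolding v_def N_def n_def by (rule vol_power_pdiff_scale[OF K(1) that])
  obtain C where C: "C > 0" "\<And>x. x \<in> K \<Longrightarrow> \<exists>y\<in>K. - x = C *\<^sub>R y"
    using reflection_constant[OF K(1,3)] by blast
  have "interior K \<noteq> {}" using K(3) by auto
  from interpolated_vol_power_pdiff[OF K(1,2) this, of q]
  obtain P where P: "degree P \<le> n" "\<And>b. b > 0 \<Longrightarrow> v 1 b = poly P b"
    unfolding n_def v_def p by (rule interpolated_imp_poly) blast
  define \<alpha> where "\<alpha> = coeff P"
  define S where "S = (\<lambda>a b. \<Sum>i\<le>n. \<alpha> i * a ^ (N - i) * b ^ i)"
  have poly_P: "poly P b = (\<Sum>i\<le>n. \<alpha> i * b ^ i)" for b
    unfolding \<alpha>_def poly_altdef using P(1)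
    by (intro sum.mono_neutral_left) (auto simp: coeff_eq_0)
  have S_pos: "S a b = a ^ N * poly P (b / a)" if "a > 0" for a b
  proof -
    have "a ^ N * (b / a) ^ i = a ^ (N - i) * b ^ i" if "i \<le> n" for i
      using \<open>a > 0\<close> that n by (simp add: power_divide power_diff)
    then show ?thesis
      unfolding S_def poly_P sum_distrib_left by (intro sum.cong) (auto simp: algebra_simps)
  qed
  have v_pos: "v a b = S a b" if "a > 0" "b > 0" for a b
    using scale[of a 1 "b / a"] P(2)[of "b / a"] that S_pos by simp
  have contP: "isCont (poly P) 0" by simp
  have "v 1 0 = poly P 0"
  proof (rule antisym)
    show "v 1 0 \<le> poly P 0"
    proof (rule isCont_le_at_right[of "\<lambda>_. v 1 0"])
      show "v 1 0 \<le> poly P b" if "b > 0" for b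
        using vol_power_pdiff_mono[OF K(1) K(1) pdiff_diag_vertex_mono[OF K0], of p 1 b] P(2)[OF that]
        by (simp add: v_def)
    qed (auto simp: contP)
    have "poly P 0 \<le> (1 + C * 0) ^ N * v 1 0"
    proof (rule isCont_le_at_right[of "poly P" "\<lambda>b. (1 + C * b) ^ N * v 1 0"])
      show "poly P b \<le> (1 + C * b) ^ N * v 1 0" if "b > 0" for b
        using vol_power_pdiff_le_body[OF K(1,2) C, of b p] P(2)[OF that] that
        by (simp add: v_def N_def n_def)
    qed (auto intro!: continuous_intros simp: contP)
    then show "poly P 0 \<le> v 1 0" by simp
  qed
  then have v_zero_right: "v a 0 = S a 0" if "a > 0" for a
    using scale[of a 1 0] that S_pos by simp
  have contS: "isCont (\<lambda>a. S a b) 0" for b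
    unfolding S_def by (intro continuous_intros)
  have lower: "v 0 b \<le> S 0 b" if "b \<ge> 0" for b
  proof (rule isCont_le_at_right[of "\<lambda>_. v 0 b" "\<lambda>a. S a b"])
    show "v 0 b \<le> S a b" if "a > 0" for a
      using vol_power_pdiff_mono[OF K(1) K(1) pdiff_body_vertex_mono[OF K0, of p b a]]
        v_pos[of a b] v_zero_right[of a] that \<open>b \<ge> 0\<close> unfolding v_def
      by (cases "b = 0") auto
  qed (auto simp: contS)
  have vn: "v a b \<ge> 0" for a b by (simp add: v_def vol_power_nonneg)
  have upper: "S 0 b \<le> v 0 b" if "b \<ge> 0" for b
  proof (cases "b = 0 \<or> q > 0")
    case True
    \<comment> \<open>\<open>0 ^ (N - i)\<close> survives only for \<open>i = N\<close>, which
      forces \<open>p = 1\<close>; then \<open>b = 0\<close> in this case, and \<open>b ^ i\<close>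
      vanishes instead.\<close>
    have "\<alpha> i * 0 ^ (N - i) * b ^ i = 0" if "i \<le> n" for i
      using True that n by (cases "i = N") (auto simp: N_def p zero_power)
    then have "S 0 b = 0" unfolding S_def by (intro sum.neutral ballI) (simp only: atMost_iff)
    then show ?thesis using vn[of 0 b] by simp
  next
    case False
    then have b: "b > 0" and p1: "p = 1" "N = n" using that by (auto simp: p N_def)
    have "S 0 b \<le> (b + C * 0) ^ n * v 0 1"
    proof (rule isCont_le_at_right[of "\<lambda>a. S a b" "\<lambda>a. (b + C * a) ^ n * v 0 1"])
      show "S a b \<le> (b + C * a) ^ n * v 0 1" if "a > 0" for a
        using vol_power_pdiff_le_diag[OF K(1,2) C, of a b] v_pos[OF that b] that b
        by (simp add: v_def n_def p1)
    qed (auto intro!: continuous_intros simp: contS)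
    then show ?thesis using scale[OF b, of 0 1] p1 by simp
  qed
  have "v a b = S a b" if "a \<ge> 0" "b \<ge> 0" for a b
    using that v_pos[of a b] v_zero_right[of a] lower[of b] upper[of b]
    by (cases "a = 0"; cases "b = 0") auto
  then show ?thesis
    unfolding pdiff_polynomial_def v_def S_def N_def n_def by blast
qed

lemma emeasure_lborel_hyperplane:
  fixes c :: "'a::euclidean_space"
  assumes "c \<noteq> 0"
  shows "emeasure lborel {x. c \<bullet> x = d} = 0"
proof -
  have "negligible {x. c \<bullet> x = d}" using assms by (intro negligible_hyperplane) simp
  then have "emeasure lebesgue {x. c \<bullet> x = d} = 0"
    using negligible_iff_emeasure0[of "{x. c \<bullet> x = d}"] negligible_imp_sets by blast
  then show ?thesis by simp
qed

text \<open>\<open>K\<close> lies in a hyperplane \<open>c \<bullet> x = d\<close>, so coordinate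
  \<open>0\<close> of every point of the body lies in the parallel one with right-hand side
  \<open>(a - b) * d\<close>. One null factor makes the product null.\<close>

lemma vol_power_pdiff_degenerate:
  fixes K :: "(real^'n) set"
  assumes K: "compact K" "convex K" "interior K = {}" and p: "p > 0"
  shows "vol_power p (pdiff p a b K) = 0"
proof -
  obtain c d where c: "c \<noteq> 0" "K \<subseteq> {x. c \<bullet> x = d}"
    using empty_interior_subset_hyperplane[OF K(2,3)] by blast
  define H where "H = {x. c \<bullet> x = (a - b) * d}"
  define A where "A = (\<lambda>i::nat. if i = 0 then H else UNIV :: (real^'n) set)"
  have A: "A i \<in> sets lborel" for i by (simp add: A_def H_def)
  have "pdiff p a b K \<subseteq> (\<Pi>\<^sub>E i\<in>{..<p}. A i)"
  proof
    fix z assume "z \<in> pdiff p a b K"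
    then obtain x y where z: "z \<in> extensional {..<p}" and xy: "x \<in> K" "y \<in> K" "z 0 + b *\<^sub>R x = a *\<^sub>R y"
      using p unfolding pdiff_def hits_def by blast
    then have "z 0 = a *\<^sub>R y - b *\<^sub>R x" by (simp add: algebra_simps)
    moreover have "c \<bullet> x = d" "c \<bullet> y = d" using c(2) xy by auto
    ultimately have "z 0 \<in> H" by (simp add: H_def inner_diff_right left_diff_distrib)
    then show "z \<in> (\<Pi>\<^sub>E i\<in>{..<p}. A i)" using z by (auto simp: PiE_iff A_def)
  qed
  then have "emeasure (lborel_power p) (pdiff p a b K) \<le> emeasure (lborel_power p) (\<Pi>\<^sub>E i\<in>{..<p}. A i)"
    using A by (intro emeasure_mono sets_PiM_I_finite) auto
  also have "\<dots> = (\<Prod>i\<in>{..<p}. emeasure lborel (A i))"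
    using A by (intro lborel_product.emeasure_PiM) auto
  also have "\<dots> = 0"
    using p emeasure_lborel_hyperplane[OF c(1)] by (auto simp: A_def H_def intro!: bexI[of _ 0])
  finally show ?thesis by (simp add: vol_power_def measure_def)
qed

text \<open>Moving an interior point of \<open>K\<close> to the origin only translates the body
  along the diagonal, so volumes do not change; a flat \<open>K\<close> has the zero
  polynomial.\<close>

proposition pdiff_polynomial_exists:
  fixes K :: "(real^'n) set"
  assumes K: "compact K" "convex K" and p: "p \<ge> 1"
  shows "\<exists>\<alpha>. pdiff_polynomial p K \<alpha>"
proof (cases "interior K = {}")
  case True
  then have "pdiff_polynomial p K (\<lambda>_. 0)"
    using vol_power_pdiff_degenerate[OF K True] p by (simp add: pdiff_polynomial_def)
  then show ?thesis by blast
next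
  case False
  then obtain c where c: "c \<in> interior K" by auto
  obtain q where q: "p = Suc q" using p by (cases p) auto
  have "0 \<in> interior ((+) (- c) ` K)"
    unfolding interior_translation using c by (auto simp: image_iff)
  then obtain \<alpha> where "pdiff_polynomial p ((+) (- c) ` K) \<alpha>"
    using pdiff_polynomial_of_zero_interior[OF compact_translation[OF K(1)] convex_translation[OF K(2)] _ q]
    by blast
  then show ?thesis
    unfolding pdiff_polynomial_def vol_power_pdiff_translation[OF K(1)] by blast
qed

section \<open>Mixed volumes as iterated one-sided derivatives\<close>

lemma convex_nonneg_sum:
  assumes "convex K" "K \<noteq> {}" "finite I" "\<And>k. k \<in> I \<Longrightarrow> s k \<ge> 0" "\<And>k. k \<in> I \<Longrightarrow> f k \<in> K"
  shows "\<exists>x\<in>K. (\<Sum>k\<in>I. s k *\<^sub>R f k) = (\<Sum>k\<in>I. s k) *\<^sub>R x"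
  using assms(3,4,5)
proof (induction I rule: finite_induct)
  case empty
  then show ?case using assms(2) by auto
next
  case (insert i I)
  then obtain x where x: "x \<in> K" "(\<Sum>k\<in>I. s k *\<^sub>R f k) = (\<Sum>k\<in>I. s k) *\<^sub>R x" by auto
  have "\<exists>z\<in>K. s i *\<^sub>R f i + (\<Sum>k\<in>I. s k) *\<^sub>R x = (s i + (\<Sum>k\<in>I. s k)) *\<^sub>R z"
    using insert.prems x by (intro convex_scaled_sum assms(1)) (auto intro: sum_nonneg)
  then show ?case using insert.hyps x(2) by simp
qed

text \<open>Nonnegative multiples of one convex set add up to a single multiple. So the volume
  depends on \<open>s\<close> only through two partial sums, and the derivatives become those of a
  polynomial in two variables.\<close>

lemma minkowski_comb_eq_pdiff:
  fixes K :: "(real^'n) set"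
  assumes K: "convex K" "K \<noteq> {}" and j: "j \<le> N" and s: "\<And>k. k < N \<Longrightarrow> s k \<ge> 0"
  shows "minkowski_comb p N s (\<lambda>k. if k < j then neg_power p (diag p ` K) else body_power p K)
    = pdiff p (\<Sum>k=j..<N. s k) (\<Sum>k<j. s k) K"
    (is "minkowski_comb p N s ?L = pdiff p ?a ?b K")
proof (intro set_eqI iffI)
  have split: "(\<Sum>k<N. h k) = (\<Sum>k<j. h k) + (\<Sum>k=j..<N. h k)" for h :: "nat \<Rightarrow> real^'n"
    using j sum.atLeastLessThan_concat[of 0 j N h] by (simp add: atLeast0LessThan)
  fix z
  {
    assume "z \<in> minkowski_comb p N s ?L"
    then obtain x where x: "\<And>k. k < N \<Longrightarrow> x k \<in> ?L k" and z: "z = (\<lambda>i\<in>{..<p}. \<Sum>k<N. s k *\<^sub>R x k i)"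
      unfolding minkowski_comb_def by blast
    have "\<exists>\<xi>. \<xi> \<in> K \<and> (\<forall>i<p. x k i = - \<xi>)" if "k < j" for k
      using x[of k] that j by (auto simp: neg_power_def diag_def)
    then obtain \<xi> where \<xi>: "\<And>k. k < j \<Longrightarrow> \<xi> k \<in> K" "\<And>k i. k < j \<Longrightarrow> i < p \<Longrightarrow> x k i = - \<xi> k"
      by metis
    obtain v where v: "v \<in> K" "(\<Sum>k<j. s k *\<^sub>R \<xi> k) = ?b *\<^sub>R v"
      using convex_nonneg_sum[OF K, of "{..<j}" s \<xi>] \<xi>(1) s j by auto
    have "\<exists>y\<in>K. z i + ?b *\<^sub>R v = ?a *\<^sub>R y" if i: "i < p" for i
    proof -
      have "x k i \<in> K" if "k \<in> {j..<N}" for k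
        using x[of k] that i by (auto simp: body_power_def)
      then obtain y where y: "y \<in> K" "(\<Sum>k=j..<N. s k *\<^sub>R x k i) = ?a *\<^sub>R y"
        using convex_nonneg_sum[OF K, of "{j..<N}" s "\<lambda>k. x k i"] s by auto
      have "(\<Sum>k<j. s k *\<^sub>R x k i) = - (\<Sum>k<j. s k *\<^sub>R \<xi> k)"
        using \<xi>(2) i by (simp add: sum_negf)
      then have "z i = - (?b *\<^sub>R v) + ?a *\<^sub>R y" using i by (simp add: z split y(2) v(2))
      then show ?thesis using y(1) by auto
    qed
    then show "z \<in> pdiff p ?a ?b K" using v(1) by (auto simp: pdiff_def hits_def z)
  next
    assume "z \<in> pdiff p ?a ?b K"
    then obtain v where z: "z \<in> extensional {..<p}" and v: "v \<in> K"
      and "\<And>i. i < p \<Longrightarrow> \<exists>y\<in>K. z i + ?b *\<^sub>R v = ?a *\<^sub>R y"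
      unfolding pdiff_def hits_def by blast
    then obtain y where y: "\<And>i. i < p \<Longrightarrow> y i \<in> K" "\<And>i. i < p \<Longrightarrow> z i + ?b *\<^sub>R v = ?a *\<^sub>R y i"
      by metis
    define x where "x = (\<lambda>k. if k < j then (\<lambda>i\<in>{..<p}. - diag p v i) else (\<lambda>i\<in>{..<p}. y i))"
    have "x k \<in> ?L k" for k
      using v y(1) by (auto simp: x_def neg_power_def body_power_def)
    moreover have "z = (\<lambda>i\<in>{..<p}. \<Sum>k<N. s k *\<^sub>R x k i)"
    proof (rule extensionalityI[OF z])
      fix i assume i: "i \<in> {..<p}"
      have "(\<Sum>k<j. s k *\<^sub>R x k i) = - (?b *\<^sub>R v)"
        using i by (simp add: x_def diag_def scaleR_sum_left sum_negf)
      moreover have "(\<Sum>k=j..<N. s k *\<^sub>R x k i) = ?a *\<^sub>R y i"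
        using i by (simp add: x_def scaleR_sum_left)
      moreover have "z i = - (?b *\<^sub>R v) + ?a *\<^sub>R y i" using y(2)[of i] i by (simp add: algebra_simps)
      ultimately show "z i = (\<lambda>i\<in>{..<p}. \<Sum>k<N. s k *\<^sub>R x k i) i" using i by (simp add: split)
    qed simp
    ultimately show "z \<in> minkowski_comb p N s ?L" unfolding minkowski_comb_def by blast
  }
qed

text \<open>\<open>fall_power c e x\<close> is the \<open>c\<close>-th derivative of \<open>x ^ e\<close>.\<close>

definition fall_power :: "nat \<Rightarrow> nat \<Rightarrow> real \<Rightarrow> real" where
  "fall_power c e x = (\<Prod>l<c. real e - real l) * x ^ (e - c)"

lemma fall_power_0: "fall_power 0 e x = x ^ e"
  by (simp add: fall_power_def)

text \<open>Subtraction in the reals makes the factor \<open>l = e\<close> zero once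
  \<open>c\<close> exceeds \<open>e\<close>, so the formula stays right after the exponent
  \<open>e - c\<close> is truncated at \<open>0\<close>.\<close>

lemma DERIV_fall_power: "(fall_power c e has_real_derivative fall_power (Suc c) e x) (at x within A)"
proof (cases "c < e")
  case True
  have "((\<lambda>x. (\<Prod>l<c. real e - real l) * x ^ (e - c)) has_real_derivative
      (\<Prod>l<c. real e - real l) * (real (e - c) * x ^ (e - c - 1))) (at x within A)"
    by (auto intro!: derivative_eq_intros)
  then show ?thesis
    using True unfolding fall_power_def [abs_def] by (simp add: of_nat_diff mult_ac)
next
  case False
  then have "(\<Prod>l<Suc c. real e - real l) = 0" by (intro prod_zero) (auto intro!: bexI[of _ e])
  then have "fall_power (Suc c) e x = 0" by (simp add: fall_power_def)
  moreover have "fall_power c e = (\<lambda>_. \<Prod>l<c. real e - real l)"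
    using False by (simp add: fall_power_def fun_eq_iff)
  ultimately show ?thesis by simp
qed

lemma fall_power_at_0:
  "fall_power c e 0 = (if c = e then fact e else 0)"
proof -
  consider "c < e" | "c = e" | "c > e" by linarith
  then show ?thesis
  proof cases
    case 2
    have "(\<Prod>l<e. real e - real l) = (\<Prod>l<e. real (e - l))"
      by (intro prod.cong) (auto simp: of_nat_diff)
    also have "\<dots> = fact e"
      using prod.nat_diff_reindex[of "\<lambda>l. real (Suc l)" e]
      by (simp add: fact_prod_Suc atLeast0LessThan Suc_diff_Suc)
    finally show ?thesis using 2 by (simp add: fall_power_def)
  next
    case 3
    then have "(\<Prod>l<c. real e - real l) = 0" by (intro prod_zero) (auto intro!: bexI[of _ e])
    then show ?thesis using 3 by (simp add: fall_power_def)
  qed (simp add: fall_power_def)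
qed

text \<open>The derivative within \<open>{0..}\<close> sees \<open>F\<close> only on the nonnegative
  orthant, so it may be replaced by \<open>G\<close>; it is unique because no point of the half-line
  is isolated.\<close>

lemma partial_nonneg_eq:
  assumes s: "\<And>k. s k \<ge> 0"
    and F: "\<And>s. (\<And>k. s k \<ge> 0) \<Longrightarrow> F s = G s"
    and G: "((\<lambda>u. G (s(k := u))) has_real_derivative D) (at (s k) within {0..})"
  shows "partial_nonneg k F s = D"
proof -
  have "at_right (s k) \<le> at (s k) within {0..}"
    using s[of k] by (intro at_le) auto
  then have nb: "at (s k) within {0..} \<noteq> bot"
    using trivial_limit_at_right_real[of "s k"] by (metis bot.extremum_unique trivial_limit_def)
  have "((\<lambda>u. F (s(k := u))) has_vector_derivative D) (at (s k) within {0..})"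
  proof (rule has_vector_derivative_transform[of _ _ _ "\<lambda>u. G (s(k := u))"])
    show "F (s(k := u)) = G (s(k := u))" if "u \<in> {0..}" for u
      using that s by (intro F) auto
    show "((\<lambda>u. G (s(k := u))) has_vector_derivative D) (at (s k) within {0..})"
      using G by (simp add: has_real_derivative_iff_has_vector_derivative)
  qed (use s in auto)
  then show ?thesis unfolding partial_nonneg_def by (rule vector_derivative_within[OF nb])
qed

text \<open>The polynomial after \<open>c\<close> derivatives in arguments of index at least
  \<open>j\<close> and \<open>d\<close> derivatives in arguments of index below \<open>j\<close>.
  Only these counts matter, as each group of arguments enters through its sum.\<close>

definition mixed_fall :: "(nat \<Rightarrow> real) \<Rightarrow> nat \<Rightarrow> nat \<Rightarrow> nat \<Rightarrow> nat \<Rightarrow> nat \<Rightarrow> (nat \<Rightarrow> real) \<Rightarrow> real" where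
  "mixed_fall \<alpha> n N j c d s =
     (\<Sum>i\<le>n. \<alpha> i * fall_power c (N - i) (\<Sum>k=j..<N. s k) * fall_power d i (\<Sum>k<j. s k))"

lemma DERIV_mixed_fall_body:
  assumes "j \<le> k" "k < N"
  shows "((\<lambda>u. mixed_fall \<alpha> n N j c d (s(k := u))) has_real_derivative
    mixed_fall \<alpha> n N j (Suc c) d s) (at (s k) within A)"
proof -
  define r where "r = (\<Sum>l\<in>{j..<N} - {k}. s l)"
  have a: "(\<Sum>l=j..<N. (s(k := u)) l) = u + r" for u
    unfolding r_def using assms by (subst sum.remove[of _ k]) (auto intro!: sum.cong)
  have b: "(\<Sum>l<j. (s(k := u)) l) = (\<Sum>l<j. s l)" for u
    using assms by (intro sum.cong) auto
  have s: "(\<Sum>l=j..<N. s l) = s k + r" using a[of "s k"] by simp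
  have shift: "((\<lambda>u. u + r) has_real_derivative 1) (at (s k) within A)"
    by (auto intro!: derivative_eq_intros)
  have "((\<lambda>u. fall_power c e (u + r)) has_real_derivative fall_power (Suc c) e (s k + r)) (at (s k) within A)" for e
    using DERIV_chain2[where g = "\<lambda>u. u + r" and x = "s k", OF DERIV_fall_power[of c e] shift] by simp
  then show ?thesis
    unfolding mixed_fall_def a b s
    by (intro DERIV_sum DERIV_cmult_right DERIV_cmult)
qed

lemma DERIV_mixed_fall_diag:
  assumes "k < j"
  shows "((\<lambda>u. mixed_fall \<alpha> n N j c d (s(k := u))) has_real_derivative
    mixed_fall \<alpha> n N j c (Suc d) s) (at (s k) within A)"
proof -
  define r where "r = (\<Sum>l\<in>{..<j} - {k}. s l)"
  have a: "(\<Sum>l<j. (s(k := u)) l) = u + r" for u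
    unfolding r_def using assms by (subst sum.remove[of _ k]) (auto intro!: sum.cong)
  have b: "(\<Sum>l=j..<N. (s(k := u)) l) = (\<Sum>l=j..<N. s l)" for u
    using assms by (intro sum.cong) auto
  have s: "(\<Sum>l<j. s l) = s k + r" using a[of "s k"] by simp
  have shift: "((\<lambda>u. u + r) has_real_derivative 1) (at (s k) within A)"
    by (auto intro!: derivative_eq_intros)
  have "((\<lambda>u. fall_power d e (u + r)) has_real_derivative fall_power (Suc d) e (s k + r)) (at (s k) within A)" for e
    using DERIV_chain2[where g = "\<lambda>u. u + r" and x = "s k", OF DERIV_fall_power[of d e] shift] by simp
  then show ?thesis
    unfolding mixed_fall_def a b s
    by (intro DERIV_sum DERIV_cmult)
qed

text \<open>Arguments are differentiated from index \<open>N - 1\<close> downwards. Of the indices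
  \<open>m, ..., N - 1\<close>, \<open>N - max m j\<close> belong to the body and
  \<open>j - m\<close>, truncated at \<open>0\<close>, to the diagonal.\<close>

lemma foldr_partial_nonneg:
  assumes j: "j \<le> N" and m: "m \<le> N"
    and F: "\<And>s. (\<And>k. s k \<ge> 0) \<Longrightarrow> F s = mixed_fall \<alpha> n N j 0 0 s"
    and s: "\<And>k. s k \<ge> 0"
  shows "foldr partial_nonneg [m..<N] F s = mixed_fall \<alpha> n N j (N - max m j) (j - m) s"
  using m s
proof (induction m arbitrary: s rule: inc_induct)
  case base
  then show ?case using F j by simp
next
  case (step m)
  have up: "[m..<N] = m # [Suc m..<N]" using step.hyps by (simp add: upt_conv_Cons)
  have "partial_nonneg m (foldr partial_nonneg [Suc m..<N] F) s = mixed_fall \<alpha> n N j (N - max m j) (j - m) s"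
  proof (rule partial_nonneg_eq[where G = "mixed_fall \<alpha> n N j (N - max (Suc m) j) (j - Suc m)"])
    show "((\<lambda>u. mixed_fall \<alpha> n N j (N - max (Suc m) j) (j - Suc m) (s(m := u))) has_real_derivative
        mixed_fall \<alpha> n N j (N - max m j) (j - m) s) (at (s m) within {0..})"
    proof (cases "j \<le> m")
      case True
      then have "N - max m j = Suc (N - max (Suc m) j)" "j - m = j - Suc m" using step.hyps by auto
      then show ?thesis using True step.hyps DERIV_mixed_fall_body by simp
    next
      case False
      then have "j - m = Suc (j - Suc m)" "max m j = max (Suc m) j" by auto
      then show ?thesis using False DERIV_mixed_fall_diag by simp
    qed
  qed (use step in auto)
  then show ?case unfolding up by simp
qed

text \<open>After \<open>N\<close> derivatives at the origin only the monomial \<open>i = j\<close>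
  survives and contributes \<open>fact (N - j) * fact j\<close>; division by \<open>fact N\<close>
  leaves the binomial coefficient.\<close>

proposition mixed_volume_eq:
  fixes K :: "(real^'n) set"
  assumes K: "convex K" "K \<noteq> {}" and p: "p \<ge> 1" and \<alpha>: "pdiff_polynomial p K \<alpha>" and j: "j \<le> CARD('n)"
  shows "mixed_volume p (\<lambda>k. if k < j then neg_power p (diag p ` K) else body_power p K)
    = \<alpha> j / real ((CARD('n) * p) choose j)"
proof -
  define n where "n = CARD('n)"
  define N where "N = n * p"
  have jN: "j \<le> n" "n \<le> N" "j \<le> N" using j p by (auto simp: N_def n_def intro: order_trans)
  let ?L = "\<lambda>k. if k < j then neg_power p (diag p ` K) else body_power p K"
  have F: "vol_power p (minkowski_comb p N s ?L) = mixed_fall \<alpha> n N j 0 0 s" if "\<And>k. s k \<ge> 0" for s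
  proof -
    have "(\<Sum>k=j..<N. s k) \<ge> 0" "(\<Sum>k<j. s k) \<ge> 0" using that by (auto intro: sum_nonneg)
    then show ?thesis
      using \<alpha> unfolding minkowski_comb_eq_pdiff[OF K jN(3) that] pdiff_polynomial_def mixed_fall_def
      by (simp add: fall_power_0 n_def N_def)
  qed
  have "foldr partial_nonneg [0..<N] (\<lambda>s. vol_power p (minkowski_comb p N s ?L)) (\<lambda>_. 0)
      = mixed_fall \<alpha> n N j (N - max 0 j) (j - 0) (\<lambda>_. 0)"
    using jN F by (intro foldr_partial_nonneg) auto
  also have "\<dots> = (\<Sum>i\<le>n. if i = j then \<alpha> j * fact (N - j) * fact j else 0)"
    unfolding mixed_fall_def using jN
    by (intro sum.cong) (auto simp: fall_power_at_0)
  also have "\<dots> = \<alpha> j * fact (N - j) * fact j" using jN by simp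
  finally have "mixed_volume p ?L = \<alpha> j * fact (N - j) * fact j / fact N"
    by (simp add: mixed_volume_def Let_def N_def n_def)
  also have "\<dots> = \<alpha> j / real (N choose j)"
    using jN by (simp add: binomial_fact field_simps)
  finally show ?thesis by (simp add: N_def n_def)
qed

section \<open>The weighted sum of mixed volumes\<close>

lemma has_integral_beta_nat:
  assumes "n > 0"
  shows "((\<lambda>u::real. u ^ m * (1 - u) ^ (n - 1)) has_integral fact m * fact (n - 1) / fact (m + n)) {0..1}"
proof -
  have "Beta (real m + 1) (real n) = fact m * fact (n - 1) / fact (m + n)"
    using Gamma_fact[of m, where 'a = real] Gamma_fact[of "n - 1", where 'a = real]
      Gamma_fact[of "m + n", where 'a = real] assms
    by (simp add: Beta_def of_nat_diff algebra_simps)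
  then have "((\<lambda>u. u powr real m * (1 - u) powr (real n - 1)) has_integral
      fact m * fact (n - 1) / fact (m + n)) {0..1}"
    using has_integral_Beta_real[of "real m + 1" "real n"] assms by simp
  then show ?thesis
  proof (rule has_integral_spike_finite[rotated 2])
    \<comment> \<open>The endpoints are exempt, since \<open>0 powr 0 = 0\<close> whereas
      \<open>0 ^ 0 = 1\<close>.\<close>
    show "u ^ m * (1 - u) ^ (n - 1) = u powr real m * (1 - u) powr (real n - 1)"
      if "u \<in> {0..1} - {0, 1}" for u :: real
    proof -
      have e: "real n - 1 = real (n - 1)" using assms by simp
      have "u powr real m = u ^ m" "(1 - u) powr real (n - 1) = (1 - u) ^ (n - 1)"
        using that by (auto intro!: powr_realpow)
      then show ?thesis unfolding e by simp
    qed
  qed simp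
qed

text \<open>The origin of the constants: \<open>(1 - t + t * u) ^ (N - j)\<close> is expanded
  binomially and each term becomes a beta integral. Dividing by the binomial coefficient matches the
  normalisation of the \<open>j\<close>-th mixed volume.\<close>

lemma mixed_coeff_has_integral:
  assumes n: "n > 0" and j: "j \<le> n * p"
  shows "((\<lambda>u. real n * (1 - u) ^ (n - 1) * ((1 - t + t * u) ^ (n * p - j) * (t * u) ^ j))
    has_integral mixed_coeff n p j t / real ((n * p) choose j)) {0..1}"
proof -
  define N where "N = n * p"
  define B where "B = (\<lambda>m. fact (N - m) * fact (n - 1) / fact (N - m + n) :: real)"
  have jN: "j \<le> N" using j by (simp add: N_def)
  have expand: "real n * (1 - u) ^ (n - 1) * ((1 - t + t * u) ^ (N - j) * (t * u) ^ j)
      = (\<Sum>m\<le>N - j. real n * real ((N - j) choose m) * (1 - t) ^ m * t ^ (N - m) * (u ^ (N - m) * (1 - u) ^ (n - 1)))"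
    for u
  proof -
    have bin: "(1 - t + t * u) ^ (N - j) = (\<Sum>m\<le>N - j. real ((N - j) choose m) * (1 - t) ^ m * (t * u) ^ (N - j - m))"
      by (rule binomial_ring)
    have pw: "(t * u) ^ (N - j - m) * (t * u) ^ j = t ^ (N - m) * u ^ (N - m)" if "m \<le> N - j" for m
    proof -
      have "N - j - m + j = N - m" using that jN by simp
      then show ?thesis by (simp flip: power_add power_mult_distrib)
    qed
    show ?thesis
      unfolding bin sum_distrib_right sum_distrib_left
    proof (rule sum.cong[OF refl])
      fix m assume "m \<in> {..N - j}"
      then have m: "m \<le> N - j" by simp
      have "real n * (1 - u) ^ (n - 1) * (real ((N - j) choose m) * (1 - t) ^ m * (t * u) ^ (N - j - m) * (t * u) ^ j)
          = real n * (1 - u) ^ (n - 1) * (real ((N - j) choose m) * (1 - t) ^ m * ((t * u) ^ (N - j - m) * (t * u) ^ j))"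
        by (simp only: mult.assoc)
      also have "\<dots> = real n * real ((N - j) choose m) * (1 - t) ^ m * t ^ (N - m) * (u ^ (N - m) * (1 - u) ^ (n - 1))"
        unfolding pw[OF m] by (simp only: mult_ac)
      finally show "real n * (1 - u) ^ (n - 1) * (real ((N - j) choose m) * (1 - t) ^ m * (t * u) ^ (N - j - m) * (t * u) ^ j)
          = real n * real ((N - j) choose m) * (1 - t) ^ m * t ^ (N - m) * (u ^ (N - m) * (1 - u) ^ (n - 1))" .
    qed
  qed
  have "((\<lambda>u. \<Sum>m\<le>N - j. real n * real ((N - j) choose m) * (1 - t) ^ m * t ^ (N - m) * (u ^ (N - m) * (1 - u) ^ (n - 1)))
      has_integral (\<Sum>m\<le>N - j. real n * real ((N - j) choose m) * (1 - t) ^ m * t ^ (N - m) * B m)) {0..1}"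
    unfolding B_def by (intro has_integral_sum has_integral_mult_right has_integral_beta_nat n) auto
  moreover have "(\<Sum>m\<le>N - j. real n * real ((N - j) choose m) * (1 - t) ^ m * t ^ (N - m) * B m)
      = mixed_coeff n p j t / real (N choose j)"
  proof -
    \<comment> \<open>In factorials \<open>fact (N - j)\<close> cancels, the
      \<open>fact (N - m)\<close> of the beta value becomes the numerator of
      \<open>(N - m) choose j\<close>, and \<open>n * fact (n - 1)\<close> is
      \<open>fact n\<close>.\<close>
    have "real n * real ((N - j) choose m) * B m * real (N choose j)
        = real ((N - m) choose j) * (fact N * fact n / (fact m * fact (N + n - m)))" if m: "m \<le> N - j" for m
    proof -
      have e: "N + n - m = N - m + n" "N - j - m = N - m - j" using m jN by auto
      have f: "fact n = real n * (fact (n - 1) :: real)" using n by (simp add: fact_reduce)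
      have b1: "real ((N - j) choose m) = fact (N - j) / (fact m * fact (N - m - j))"
        using m e by (simp add: binomial_fact)
      have b2: "real (N choose j) = fact N / (fact j * fact (N - j))"
        using jN by (simp add: binomial_fact)
      have b3: "real ((N - m) choose j) = fact (N - m) / (fact j * fact (N - m - j))"
        using m jN by (simp add: binomial_fact)
      show ?thesis unfolding b1 b2 b3 e(1) f B_def by (simp add: mult_ac)
    qed
    note prod_eq = this
    have "real (N choose j) \<noteq> 0" using jN by simp
    then have "real n * real ((N - j) choose m) * B m
        = real ((N - m) choose j) * (fact N * fact n / (fact m * fact (N + n - m))) / real (N choose j)"
      if "m \<le> N - j" for m
      unfolding prod_eq[OF that, symmetric] by simp
    then have "(\<Sum>m\<le>N - j. (real n * real ((N - j) choose m) * B m) * ((1 - t) ^ m * t ^ (N - m)))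
        = (\<Sum>m\<le>N - j. real ((N - m) choose j) * (fact N * fact n / (fact m * fact (N + n - m)))
            / real (N choose j) * ((1 - t) ^ m * t ^ (N - m)))"
      by (intro sum.cong refl) (simp only: atMost_iff)
    then show ?thesis
      by (simp add: mixed_coeff_def N_def[symmetric] atLeast0AtMost sum_divide_distrib mult_ac)
  qed
  ultimately show ?thesis unfolding N_def[symmetric] expand by (simp only:)
qed

definition weighted_mixed_sum :: "nat \<Rightarrow> real \<Rightarrow> (real^'n) set \<Rightarrow> real" where
  "weighted_mixed_sum p t K = (\<Sum>j = 0..CARD('n). mixed_coeff CARD('n) p j t
     * mixed_volume p (\<lambda>k. if k < j then neg_power p (diag p ` K) else body_power p K))"

text \<open>Both coefficients are nonnegative for \<open>u\<close> in \<open>[0, 1]\<close>, so the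
  polynomial form applies and is integrated monomial by monomial. Continuity will serve for
  measurability and for comparing integrands pointwise.\<close>

lemma weighted_mixed_sum_has_integral:
  fixes K :: "(real^'n) set"
  assumes K: "compact K" "convex K" "K \<noteq> {}" and p: "p \<ge> 1" and t: "0 \<le> t" "t \<le> 1"
  shows "((\<lambda>u. real CARD('n) * (1 - u) ^ (CARD('n) - 1) * vol_power p (pdiff p (1 - t + t * u) (t * u) K))
    has_integral weighted_mixed_sum p t K) {0..1}"
    and "continuous_on {0..1} (\<lambda>u. vol_power p (pdiff p (1 - t + t * u) (t * u) K))"
proof -
  define n where "n = CARD('n)"
  define N where "N = n * p"
  have n: "n > 0" "n \<le> N" using p by (auto simp: n_def N_def)
  obtain \<alpha> where \<alpha>: "pdiff_polynomial p K \<alpha>" using pdiff_polynomial_exists[OF K(1,2) p] by blast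
  have v: "vol_power p (pdiff p (1 - t + t * u) (t * u) K)
      = (\<Sum>j\<le>n. \<alpha> j * ((1 - t + t * u) ^ (N - j) * (t * u) ^ j))" if "u \<in> {0..1}" for u
  proof -
    have "1 - t + t * u \<ge> 0" "t * u \<ge> 0" using that t by auto
    then show ?thesis using \<alpha> by (simp add: pdiff_polynomial_def n_def N_def mult.assoc)
  qed
  have "continuous_on {0..1} (\<lambda>u. \<Sum>j\<le>n. \<alpha> j * ((1 - t + t * u) ^ (N - j) * (t * u) ^ j))"
    by (intro continuous_intros)
  then show "continuous_on {0..1} (\<lambda>u. vol_power p (pdiff p (1 - t + t * u) (t * u) K))"
    by (rule continuous_on_eq) (simp add: v)
  have "((\<lambda>u. \<Sum>j\<le>n. \<alpha> j * (real n * (1 - u) ^ (n - 1) * ((1 - t + t * u) ^ (N - j) * (t * u) ^ j)))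
      has_integral (\<Sum>j\<le>n. \<alpha> j * (mixed_coeff n p j t / real (N choose j)))) {0..1}"
    using n order_trans[OF _ n(2)] unfolding N_def
    by (intro has_integral_sum has_integral_mult_right mixed_coeff_has_integral) simp_all
  moreover have "(\<Sum>j\<le>n. \<alpha> j * (mixed_coeff n p j t / real (N choose j))) = weighted_mixed_sum p t K"
    unfolding weighted_mixed_sum_def n_def N_def atLeast0AtMost
    by (intro sum.cong refl) (simp add: mixed_volume_eq[OF K(2,3) p \<alpha>])
  ultimately have "((\<lambda>u. \<Sum>j\<le>n. \<alpha> j * (real n * (1 - u) ^ (n - 1) * ((1 - t + t * u) ^ (N - j) * (t * u) ^ j)))
      has_integral weighted_mixed_sum p t K) {0..1}" by simp
  then have "((\<lambda>u. real n * (1 - u) ^ (n - 1) * vol_power p (pdiff p (1 - t + t * u) (t * u) K))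
      has_integral weighted_mixed_sum p t K) {0..1}"
  proof (rule has_integral_eq[rotated])
    fix u :: real assume u: "u \<in> {0..1}"
    show "(\<Sum>j\<le>n. \<alpha> j * (real n * (1 - u) ^ (n - 1) * ((1 - t + t * u) ^ (N - j) * (t * u) ^ j)))
        = real n * (1 - u) ^ (n - 1) * vol_power p (pdiff p (1 - t + t * u) (t * u) K)"
      unfolding v[OF u] sum_distrib_left by (intro sum.cong refl) (simp only: mult_ac)
  qed
  then show "((\<lambda>u. real CARD('n) * (1 - u) ^ (CARD('n) - 1) * vol_power p (pdiff p (1 - t + t * u) (t * u) K))
      has_integral weighted_mixed_sum p t K) {0..1}"
    by (simp add: n_def)
qed

lemma measure_pos_of_interior:
  fixes K :: "'a::euclidean_space set"
  assumes "compact K" "interior K \<noteq> {}"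
  shows "measure lborel K > 0"
proof -
  have "\<not> negligible K"
    using assms(2) open_not_negligible[OF open_interior] negligible_subset[OF _ interior_subset] by blast
  then have "measure lebesgue K \<noteq> 0"
    using negligible_iff_measure[of K] lmeasurable_compact[OF assms(1)] by auto
  then show ?thesis
    using assms(1) by (simp add: borel_compact zero_less_measure_iff)
qed

text \<open>The Fubini estimate divides by the volume of \<open>t K\<close>, so two cases are split
  off: flat bodies, where the sum is \<open>0\<close>, and \<open>t = 0\<close>, where the integrand
  is \<open>measure lborel K ^ p\<close> times a weight of total mass \<open>1\<close>.\<close>

proposition weighted_mixed_sum_le:
  fixes K :: "(real^'n) set"
  assumes K: "compact K" "convex K" "K \<noteq> {}" and p: "p \<ge> 1" and t: "0 \<le> t" "t \<le> 1"
  shows "weighted_mixed_sum p t K \<le> measure lborel K ^ p"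
proof -
  let ?n = "CARD('n)"
  let ?v = "\<lambda>u. vol_power p (pdiff p (1 - t + t * u) (t * u) K)"
  let ?f = "\<lambda>u. real ?n * (1 - u) ^ (?n - 1) * ?v u"
  note I = weighted_mixed_sum_has_integral[OF K p t]
  consider "interior K = {}" | "t = 0" | "interior K \<noteq> {}" "t > 0" using t by fastforce
  then show ?thesis
  proof cases
    case 1
    have "?f = (\<lambda>u. 0)" using vol_power_pdiff_degenerate[OF K(1,2) 1] p by simp
    then have "weighted_mixed_sum p t K = 0" using I(1) by simp
    then show ?thesis by simp
  next
    case 2
    have "((\<lambda>u. (real ?n * measure lborel K ^ p) * (u ^ 0 * (1 - u) ^ (?n - 1))) has_integral
        (real ?n * measure lborel K ^ p) * (fact 0 * fact (?n - 1) / fact (0 + ?n))) {0..1}"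
      by (intro has_integral_mult_right has_integral_beta_nat) simp
    moreover have "(\<lambda>u. (real ?n * measure lborel K ^ p) * (u ^ 0 * (1 - u) ^ (?n - 1))) = ?f"
      using vol_power_pdiff_one_zero[OF K(1,3)] 2 by (simp add: mult_ac)
    ultimately have "(?f has_integral (real ?n * measure lborel K ^ p) * (fact 0 * fact (?n - 1) / fact (0 + ?n))) {0..1}"
      by simp
    then have "weighted_mixed_sum p t K = (real ?n * measure lborel K ^ p) * (fact 0 * fact (?n - 1) / fact (0 + ?n))"
      by (rule has_integral_unique[OF I(1)])
    also have "\<dots> = measure lborel K ^ p" by (simp add: fact_reduce[of ?n])
    finally show ?thesis by simp
  next
    case 3
    have pos: "measure lborel K > 0" using K(1) 3(1) by (rule measure_pos_of_interior)
    have nn: "indicator {0..1} u * ?f u \<ge> 0" for u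
      by (auto simp: vol_power_nonneg indicator_def intro!: mult_nonneg_nonneg)
    have "continuous_on {0..1} ?f" by (intro continuous_intros I(2))
    then have m: "(\<lambda>u. indicator {0..1} u * ?f u) \<in> borel_measurable borel"
      using borel_measurable_continuous_on_indicator[of "{0..1::real}" ?f] by simp
    have "((\<lambda>u. indicator {0..1} u * ?f u) has_integral weighted_mixed_sum p t K) UNIV"
    proof -
      have ind: "(\<lambda>u. indicator {0..1} u * ?f u) = (\<lambda>u. if u \<in> {0..1} then ?f u else 0)"
        by (simp add: fun_eq_iff indicator_def)
      show ?thesis unfolding ind has_integral_restrict_UNIV by (rule I(1))
    qed
    from nn_integral_has_integral_lborel[OF m nn this]
    have "ennreal (weighted_mixed_sum p t K) = (\<integral>\<^sup>+u. ennreal (indicator {0..1} u * ?f u) \<partial>lborel)"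
      by simp
    also have "\<dots> = (\<integral>\<^sup>+u. ennreal (indicator {0..1} u * (real ?n * (1 - u) ^ (?n - 1)))
        * emeasure (lborel_power p) (pdiff p (1 - t + t * u) (t * u) K) \<partial>lborel)"
    proof (rule nn_integral_cong)
      fix u
      have "emeasure (lborel_power p) (pdiff p (1 - t + t * u) (t * u) K) = ennreal (?v u)"
        unfolding vol_power_def
        using emeasure_pdiff_finite[OF K(1), of p "1 - t + t * u" "t * u"]
        by (intro emeasure_eq_ennreal_measure) auto
      then show "ennreal (indicator {0..1} u * ?f u) = ennreal (indicator {0..1} u * (real ?n * (1 - u) ^ (?n - 1)))
          * emeasure (lborel_power p) (pdiff p (1 - t + t * u) (t * u) K)"
        by (simp add: ennreal_mult'' vol_power_nonneg flip: mult.assoc)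
    qed
    also have "\<dots> \<le> ennreal (measure lborel K ^ p)"
      by (rule nn_integral_weighted_pdiff_le[OF K(1,2) pos 3(2) t(2)])
    finally show ?thesis by (simp add: ennreal_le_iff)
  qed
qed

section \<open>The unbalanced difference body and the equality case\<close>

lemma unbalanced_difference_body_eq_pdiff:
  "unbalanced_difference_body p t K = pdiff p (1 - t) t K"
proof (intro set_eqI iffI)
  fix z assume "z \<in> unbalanced_difference_body p t K"
  then obtain x y where xy: "x \<in> K" "y \<in> body_power p K"
      and z: "z = (\<lambda>i\<in>{..<p}. (1 - t) *\<^sub>R y i - t *\<^sub>R diag p x i)"
    unfolding unbalanced_difference_body_def by blast
  then have "\<exists>v\<in>K. z i + t *\<^sub>R x = (1 - t) *\<^sub>R v" if "i < p" for i
    using that by (intro bexI[of _ "y i"]) (auto simp: diag_def body_power_def)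
  then show "z \<in> pdiff p (1 - t) t K" using xy(1) unfolding pdiff_def hits_def z by blast
next
  fix z assume "z \<in> pdiff p (1 - t) t K"
  then obtain x where z: "z \<in> extensional {..<p}" and x: "x \<in> K"
      and "\<And>i. i < p \<Longrightarrow> \<exists>y\<in>K. z i + t *\<^sub>R x = (1 - t) *\<^sub>R y"
    unfolding pdiff_def hits_def by blast
  then obtain y where y: "\<And>i. i < p \<Longrightarrow> y i \<in> K" "\<And>i. i < p \<Longrightarrow> z i + t *\<^sub>R x = (1 - t) *\<^sub>R y i"
    by metis
  have "restrict y {..<p} \<in> body_power p K" using y(1) by (auto simp: body_power_def)
  moreover have "z = (\<lambda>i\<in>{..<p}. (1 - t) *\<^sub>R restrict y {..<p} i - t *\<^sub>R diag p x i)"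
    by (rule extensionalityI[OF z]) (simp_all add: diag_def flip: y(2))
  ultimately show "z \<in> unbalanced_difference_body p t K"
    using x unfolding unbalanced_difference_body_def by blast
qed

lemma vol_power_pdiff_eq_unbalanced:
  fixes K :: "(real^'n) set"
  assumes "compact K" "a + b > 0"
  shows "vol_power p (pdiff p a b K) =
    (a + b) ^ (CARD('n) * p) * vol_power p (unbalanced_difference_body p (b / (a + b)) K)"
proof -
  have "(a + b) * (1 - b / (a + b)) = a" "(a + b) * (b / (a + b)) = b"
    using assms(2) by (simp_all add: field_simps)
  then show ?thesis
    using vol_power_pdiff_scale[OF assms, of p "1 - b / (a + b)" "b / (a + b)"]
    by (simp add: unbalanced_difference_body_eq_pdiff)
qed

lemma interior_nonempty_of_aff_dim:
  fixes K :: "(real^'n) set"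
  assumes "convex K" "aff_dim K = int CARD('n)"
  shows "interior K \<noteq> {}"
proof -
  have "affine hull K = UNIV" using aff_dim_eq_full[of K] assms(2) by simp
  then have "rel_interior K = interior K" by (rule rel_interior_interior)
  moreover have "K \<noteq> {}" using assms(2) by auto
  ultimately show ?thesis using rel_interior_eq_empty[OF assms(1)] by simp
qed

theorem proposition6p4:
  fixes S :: "(real ^ 'n) set"
  assumes "CARD('n) \<ge> 2"
    and "int CARD('n) simplex S"
    and "\<And>p K t. p \<ge> 1 \<Longrightarrow> convex_body (K :: (real ^ 'n) set) \<Longrightarrow> aff_dim K = int CARD('n)
           \<Longrightarrow> t \<in> {0..1}
           \<Longrightarrow> vol_power p (unbalanced_difference_body p t K) / measure lborel K ^ p
             \<le> vol_power p (unbalanced_difference_body p t S) / measure lborel S ^ p"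
    and "\<And>p K t. p \<ge> 1 \<Longrightarrow> convex_body (K :: (real ^ 'n) set) \<Longrightarrow> aff_dim K = int CARD('n)
           \<Longrightarrow> t \<in> {0<..<1}
           \<Longrightarrow> vol_power p (unbalanced_difference_body p t K) / measure lborel K ^ p
             = vol_power p (unbalanced_difference_body p t S) / measure lborel S ^ p
           \<Longrightarrow> \<exists>d. d simplex K"
  shows "\<forall>p \<ge> 1. \<forall>K :: (real ^ 'n) set. convex_body K \<longrightarrow>
    (\<forall>t \<in> {0..1}.
       (\<Sum>j = 0..CARD('n). mixed_coeff CARD('n) p j t
          * mixed_volume p (\<lambda>k. if k < j then neg_power p (diag p ` K) else body_power p K))
       \<le> measure lborel K ^ p) \<and>
    (aff_dim K = int CARD('n) \<longrightarrow>
      (\<exists>t \<in> {0<..<1}.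
         (\<Sum>j = 0..CARD('n). mixed_coeff CARD('n) p j t
            * mixed_volume p (\<lambda>k. if k < j then neg_power p (diag p ` K) else body_power p K))
         = measure lborel K ^ p) \<longrightarrow>
      (\<exists>d. d simplex K))"
  unfolding weighted_mixed_sum_def[symmetric]
proof (intro allI impI conjI ballI)
  fix p :: nat and K :: "(real^'n) set" and t :: real
  assume "p \<ge> 1" "convex_body K" "t \<in> {0..1}"
  then show "weighted_mixed_sum p t K \<le> measure lborel K ^ p"
    by (intro weighted_mixed_sum_le) (auto simp: convex_body_def)
next
  fix p :: nat and K :: "(real^'n) set"
  assume p: "p \<ge> 1" and "convex_body K" and dim: "aff_dim K = int CARD('n)"
    and "\<exists>t\<in>{0<..<1}. weighted_mixed_sum p t K = measure lborel K ^ p"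
  then obtain t where t: "0 < t" "t < 1" and eq: "weighted_mixed_sum p t K = measure lborel K ^ p"
    by auto
  let ?n = "CARD('n)"
  have K: "compact K" "convex K" "K \<noteq> {}" using \<open>convex_body K\<close> by (auto simp: convex_body_def)
  have S: "compact S" "convex S" "aff_dim S = int ?n"
    using assms(2) by (auto simp: compact_simplex convex_simplex aff_dim_simplex)
  then have "S \<noteq> {}" by auto
  have Kpos: "measure lborel K ^ p > 0"
    using measure_pos_of_interior[OF K(1) interior_nonempty_of_aff_dim[OF K(2) dim]] by simp
  have Spos: "measure lborel S ^ p > 0"
    using measure_pos_of_interior[OF S(1) interior_nonempty_of_aff_dim[OF S(2,3)]] by simp
  define v where "v = (\<lambda>(L :: (real^'n) set) u. vol_power p (pdiff p (1 - t + t * u) (t * u) L))"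
  \<comment> \<open>By homogeneity \<open>g u\<close> is a positive factor times the gap between the
    two volume ratios at parameter \<open>t * u / (1 - t + 2 * t * u)\<close>.\<close>
  define g where "g = (\<lambda>u. v S u / measure lborel S ^ p - v K u / measure lborel K ^ p)"
  have v_eq: "v L u = (1 - t + 2 * t * u) ^ (?n * p)
      * vol_power p (unbalanced_difference_body p (t * u / (1 - t + 2 * t * u)) L)"
    if "compact L" "u \<ge> 0" for L u
  proof -
    have e: "1 - t + t * u + t * u = 1 - t + 2 * t * u" by simp
    have "1 - t + t * u + t * u > 0" unfolding e using t that by (auto intro!: add_pos_nonneg)
    from vol_power_pdiff_eq_unbalanced[OF that(1) this, of p]
    show ?thesis unfolding v_def e .
  qed
  have g_nonneg: "g u \<ge> 0" if "0 \<le> u" "u \<le> 1" for u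
  proof -
    have den: "1 - t + 2 * t * u > 0" using t that by (intro add_pos_nonneg) auto
    have "t * u \<le> t" using t that by (simp add: mult_left_le)
    then have "t * u / (1 - t + 2 * t * u) \<in> {0..1}" using den t that by (auto simp: divide_le_eq)
    from assms(3)[OF p \<open>convex_body K\<close> dim this]
    show ?thesis
      unfolding g_def v_eq[OF K(1) that(1)] v_eq[OF S(1) that(1)]
      using den by (simp add: mult_left_mono flip: times_divide_eq_right)
  qed
  have integral: "((\<lambda>u. real ?n * (1 - u) ^ (?n - 1) * g u) has_integral
      (weighted_mixed_sum p t S / measure lborel S ^ p - weighted_mixed_sum p t K / measure lborel K ^ p)) {0..1}"
    (is "(?h has_integral ?I) _")
  proof -
    have "((\<lambda>u. (real ?n * (1 - u) ^ (?n - 1) * v S u) / measure lborel S ^ p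
        - (real ?n * (1 - u) ^ (?n - 1) * v K u) / measure lborel K ^ p) has_integral ?I) {0..1}"
      unfolding v_def using t p
      by (intro has_integral_diff has_integral_divide weighted_mixed_sum_has_integral K S \<open>S \<noteq> {}\<close>) auto
    then show ?thesis by (simp add: g_def right_diff_distrib)
  qed
  have cont: "continuous_on {0..1} ?h"
    unfolding g_def v_def using t p Kpos Spos
    by (intro continuous_intros weighted_mixed_sum_has_integral(2) K S \<open>S \<noteq> {}\<close>)
      (auto simp: power_0_left)
  \<comment> \<open>The inequality applied to the simplex itself closes the sandwich: the integral
    of a nonnegative function is at most \<open>1 - 1\<close>.\<close>
  have "weighted_mixed_sum p t S / measure lborel S ^ p \<le> 1"
    using weighted_mixed_sum_le[OF S(1,2) \<open>S \<noteq> {}\<close> p, of t] t Spos by simp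
  moreover have "weighted_mixed_sum p t K / measure lborel K ^ p = 1"
    unfolding eq using less_imp_neq[OF Kpos] by (intro divide_self) (rule not_sym)
  ultimately have "?I \<le> 0" by linarith
  moreover have h_nonneg: "?h u \<ge> 0" if "u \<in> {0..1}" for u
    using g_nonneg[of u] that by simp
  then have "?I \<ge> 0" using has_integral_nonneg[OF integral] by blast
  ultimately have "?I = 0" by simp
  \<comment> \<open>Any interior \<open>u\<close> would do; at \<open>1 / 2\<close> the two
    coefficients sum to \<open>1\<close>, so the parameter is simply \<open>t / 2\<close>, strictly
    between \<open>0\<close> and \<open>1\<close>.\<close>
  then have "?h (1 / 2) = 0"
    using has_integral_0_cbox_imp_0[of 0 "1::real" ?h "1 / 2"] integral cont h_nonneg by simp
  then have "g (1 / 2) = 0" by simp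
  then have "v K (1 / 2) / measure lborel K ^ p = v S (1 / 2) / measure lborel S ^ p"
    by (simp add: g_def)
  then have "vol_power p (unbalanced_difference_body p (t / 2) K) / measure lborel K ^ p
      = vol_power p (unbalanced_difference_body p (t / 2) S) / measure lborel S ^ p"
    using v_eq[OF K(1), of "1 / 2"] v_eq[OF S(1), of "1 / 2"] by simp
  then show "\<exists>d. d simplex K"
    using t by (intro assms(4)[OF p \<open>convex_body K\<close> dim, of "t / 2"]) auto
qed

end
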